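(* Let $n\ge 1$, $m\ge 0$, let $\lambda$ be a partition of length at most $n$ and let $r\ge 1$ be an integer. Then $$P_r(X,\overline{X}/Y)\,\mathrm{spo}_{\lambda}(X/Y)=\sum_{\eta/\lambda\in \mathrm{BS}(r)}(-1)^{\mathrm{ht}(\eta/\lambda)}\,\mathrm{spo}_{\eta}(X/Y)+\sum_{\lambda/\xi\in \mathrm{BS}(r)}(-1)^{\mathrm{ht}(\lambda/\xi)}\,\mathrm{spo}_{\xi}(X/Y)+\sum_{\substack{\mu\subseteq\lambda\\ \mu_n<r-1}}\Biggl(\sum_{q=m(\mu)+1}^{n}(-1)^{p(q)-q+1}\,\mathrm{sp}_{\mu^{(q)}}(X)\Biggr)s_{\lambda'/\mu'}(Y),$$ where the first sum is over partitions $\eta\supseteq\lambda$ such that $\eta/\lambda$ is a border strip with $r$ boxes, the second is over partitions $\xi\subseteq\lambda$ such that $\lambda/\xi$ is a border strip with $r$ boxes, and the third is over partitions $\mu\subseteq\lambda$ with $\mu_n<r-1$.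
   Context: Let $X=(x_1,\dots,x_n)$ and $Y=(y_1,\dots,y_m)$ be commuting indeterminates, $\bar x_i=x_i^{-1}$, $\overline X=(\bar x_1,\dots,\bar x_n)$. Put $$P_r(X,\overline X/Y)=\sum_{i=1}^n(x_i^r+\bar x_i^{\,r})+(-1)^{r-1}\sum_{j=1}^m y_j^r.$$ Partitions are identified with their Young diagrams; $\lambda'$ is the conjugate of $\lambda$. A border strip is a (nonempty) skew diagram that is connected (any two boxes are joined by a sequence of boxes, consecutive ones sharing a side) and contains no $2\times2$ block of boxes. Its height $\mathrm{ht}$ is one less than its number of nonempty rows. $\mathrm{BS}(r)$ denotes the border strips with exactly $r$ boxes. For a partition $\lambda=(\lambda_1,\dots,\lambda_n)$ of length at most $n$ (padded with zeros), the symplectic Schur polynomial is $$\mathrm{sp}_{\lambda}(X)=\frac{\det_{1\le i,j\le n}\bigl(x_i^{\lambda_j+n-j+1}-\bar x_i^{\lambda_j+n-j+1}\bigr)}{\det_{1\le i,j\le n}\bigl(x_i^{n-j+1}-\bar x_i^{n-j+1}\bigr)};$$ for partitions of length greater than $n$, $\mathrm{sp}_\lambda(X)=0$. The skew Schur polynomial $s_{\alpha/\beta}(Y)$ is the sum over semistandard tableaux of shape $\alpha/\beta$ with entries in $\{1,\dots,m\}$ (rows weakly increasing, columns strictly increasing) of the monomials $\prod_j y_j^{\#j}$ (for $m=0$ it is $1$ if $\alpha=\beta$ and $0$ otherwise). For any partition $\lambda$, the orthosymplectic Schur polynomial is $$\mathrm{spo}_\lambda(X/Y)=\sum_{\mu\subseteq\lambda}\mathrm{sp}_\mu(X)\,s_{\lambda'/\mu'}(Y).$$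 Let $\delta=(n,n-1,\dots,1)$. For a partition $\mu$ of length at most $n$, define $m(\mu)=0$ if $\mu_i+\delta_i<r$ for all $i\in\{1,\dots,n\}$, and $m(\mu)=\max\{i\mid \mu_i+\delta_i\ge r\}$ otherwise (not to be confused with the number $m$ of variables in $Y$). For $q$ with $\mu_q+\delta_q-r<0$ (i.e. $q>m(\mu)$), let $\Delta_q$ be the rearrangement in descending order of $$(\mu_1+\delta_1,\dots,\mu_{q-1}+\delta_{q-1},\,r-(\mu_q+\delta_q),\,\mu_{q+1}+\delta_{q+1},\dots,\mu_n+\delta_n),$$ and set $\mu^{(q)}=\Delta_q-\delta$. If $r-(\mu_q+\delta_q)=\mu_j+\delta_j$ for some $j\ne q$, then $\mu^{(q)}$ is not a partition and one sets $\mathrm{sp}_{\mu^{(q)}}=0$ (the corresponding term is $0$). Otherwise $\mu^{(q)}$ is a partition and $p(q)$ denotes the index (position) of the entry $r-(\mu_q+\delta_q)$ in $\Delta_q$. (Both $\mu^{(q)}$ and $p(q)$ depend on $\mu$.) *)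

theory Defs
  imports
    "HOL-Library.Poly_Mapping"
    "HOL-Library.FuncSet"
    "HOL-Computational_Algebra.Fraction_Field"
    "Jordan_Normal_Form.Determinant"
begin

section \<open>Partitions and skew diagrams\<close>

text \<open>All indices are 1-based: the parts of \<open>\<mu>\<close> are \<open>\<mu> 1, \<mu> 2, \<dots>\<close>, and the unused value
  \<open>\<mu> 0\<close> is fixed to be \<open>0\<close>, so that equal partitions are equal functions.\<close>

definition is_partition :: "(nat \<Rightarrow> nat) \<Rightarrow> bool" where
  "is_partition \<mu> \<longleftrightarrow> \<mu> 0 = 0 \<and> (\<forall>i\<ge>1. \<mu> (Suc i) \<le> \<mu> i) \<and> finite {i. \<mu> i \<noteq> 0}"

definition num_parts :: "(nat \<Rightarrow> nat) \<Rightarrow> nat" where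
  "num_parts \<mu> = card {i. \<mu> i \<noteq> 0}"

definition diagram :: "(nat \<Rightarrow> nat) \<Rightarrow> (nat \<times> nat) set" where
  "diagram \<mu> = {(i, j). 1 \<le> i \<and> 1 \<le> j \<and> j \<le> \<mu> i}"

definition conj_partition :: "(nat \<Rightarrow> nat) \<Rightarrow> nat \<Rightarrow> nat" where
  "conj_partition \<mu> j = card {i. (i, j) \<in> diagram \<mu>}"

definition skew :: "(nat \<Rightarrow> nat) \<Rightarrow> (nat \<Rightarrow> nat) \<Rightarrow> (nat \<times> nat) set" where
  "skew \<alpha> \<beta> = diagram \<alpha> - diagram \<beta>"

definition is_skew_diagram :: "(nat \<times> nat) set \<Rightarrow> bool" where
  "is_skew_diagram S \<longleftrightarrow>
     (\<exists>\<alpha> \<beta>. is_partition \<alpha> \<and> is_partition \<beta> \<and> diagram \<beta> \<subseteq> diagram \<alpha> \<and> S = skew \<alpha> \<beta>)"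

fun share_side :: "nat \<times> nat \<Rightarrow> nat \<times> nat \<Rightarrow> bool" where
  "share_side (i, j) (k, l) \<longleftrightarrow>
     (i = k \<and> (j = Suc l \<or> l = Suc j)) \<or> (j = l \<and> (i = Suc k \<or> k = Suc i))"

definition boxes_connected :: "(nat \<times> nat) set \<Rightarrow> bool" where
  "boxes_connected S \<longleftrightarrow>
     (\<forall>a\<in>S. \<forall>b\<in>S. (a, b) \<in> {(c, d). c \<in> S \<and> d \<in> S \<and> share_side c d}\<^sup>*)"

definition border_strip :: "(nat \<times> nat) set \<Rightarrow> bool" where
  "border_strip S \<longleftrightarrow> is_skew_diagram S \<and> S \<noteq> {} \<and> boxes_connected S \<and>
     \<not> (\<exists>i j. {(i, j), (Suc i, j), (i, Suc j), (Suc i, Suc j)} \<subseteq> S)"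

definition BS :: "nat \<Rightarrow> (nat \<times> nat) set set" where
  "BS r = {S. border_strip S \<and> card S = r}"

definition ht :: "(nat \<times> nat) set \<Rightarrow> nat" where
  "ht S = card (fst ` S) - 1"

section \<open>Symplectic, skew and orthosymplectic Schur polynomials\<close>

text \<open>The polynomials are defined for arbitrary elements \<open>x 1, \<dots>, x n\<close> and \<open>y 1, \<dots>, y m\<close> of a
  field; the indeterminates are introduced in the last section.\<close>

definition det1 :: "nat \<Rightarrow> (nat \<Rightarrow> nat \<Rightarrow> 'a::comm_ring_1) \<Rightarrow> 'a" where
  "det1 n a = det (mat n n (\<lambda>(i, j). a (i + 1) (j + 1)))"

definition sp :: "nat \<Rightarrow> (nat \<Rightarrow> 'a::field) \<Rightarrow> (nat \<Rightarrow> nat) \<Rightarrow> 'a" where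
  "sp n x \<mu> =
     (if num_parts \<mu> \<le> n
      then det1 n (\<lambda>i j. x i ^ (\<mu> j + n - j + 1) - inverse (x i) ^ (\<mu> j + n - j + 1)) /
           det1 n (\<lambda>i j. x i ^ (n - j + 1) - inverse (x i) ^ (n - j + 1))
      else 0)"

text \<open>Extensional functions make the set of tableaux of a given shape finite; there is exactly
  one tableau of empty shape.\<close>

definition ssyt :: "nat \<Rightarrow> (nat \<times> nat) set \<Rightarrow> (nat \<times> nat \<Rightarrow> nat) set" where
  "ssyt m S = {T \<in> S \<rightarrow>\<^sub>E {1..m}.
     (\<forall>i j l. (i, j) \<in> S \<and> (i, l) \<in> S \<and> j < l \<longrightarrow> T (i, j) \<le> T (i, l)) \<and>
     (\<forall>i k j. (i, j) \<in> S \<and> (k, j) \<in> S \<and> i < k \<longrightarrow> T (i, j) < T (k, j))}"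

definition skew_schur ::
    "nat \<Rightarrow> (nat \<Rightarrow> 'a::field) \<Rightarrow> (nat \<Rightarrow> nat) \<Rightarrow> (nat \<Rightarrow> nat) \<Rightarrow> 'a" where
  "skew_schur m y \<alpha> \<beta> =
     (\<Sum>T\<in>ssyt m (skew \<alpha> \<beta>). \<Prod>j=1..m. y j ^ card {b \<in> skew \<alpha> \<beta>. T b = j})"

definition spo ::
    "nat \<Rightarrow> nat \<Rightarrow> (nat \<Rightarrow> 'a::field) \<Rightarrow> (nat \<Rightarrow> 'a) \<Rightarrow> (nat \<Rightarrow> nat) \<Rightarrow> 'a" where
  "spo n m x y \<nu> =
     (\<Sum>\<mu> | is_partition \<mu> \<and> diagram \<mu> \<subseteq> diagram \<nu>.
        sp n x \<mu> * skew_schur m y (conj_partition \<nu>) (conj_partition \<mu>))"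

definition power_sum :: "nat \<Rightarrow> nat \<Rightarrow> nat \<Rightarrow> (nat \<Rightarrow> 'a::field) \<Rightarrow> (nat \<Rightarrow> 'a) \<Rightarrow> 'a" where
  "power_sum r n m x y =
     (\<Sum>i=1..n. x i ^ r + inverse (x i) ^ r) + (-1) ^ (r - 1) * (\<Sum>j=1..m. y j ^ r)"

section \<open>The modified partitions \<open>\<mu>\<^sup>(\<^sup>q\<^sup>)\<close>\<close>

definition delta :: "nat \<Rightarrow> nat \<Rightarrow> nat" where
  "delta n i = n + 1 - i"

definition m_index :: "nat \<Rightarrow> nat \<Rightarrow> (nat \<Rightarrow> nat) \<Rightarrow> nat" where
  "m_index n r \<mu> =
     (if \<forall>i\<in>{1..n}. \<mu> i + delta n i < r then 0
      else Max {i \<in> {1..n}. \<mu> i + delta n i \<ge> r})"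

text \<open>The following definitions are only meaningful for \<open>1 \<le> q \<le> n\<close> and \<open>\<mu> q + delta n q < r\<close>,
  where the subtraction in \<open>new_entry\<close> does not truncate.\<close>

definition new_entry :: "nat \<Rightarrow> nat \<Rightarrow> (nat \<Rightarrow> nat) \<Rightarrow> nat \<Rightarrow> nat" where
  "new_entry n r \<mu> q = r - (\<mu> q + delta n q)"

definition Delta :: "nat \<Rightarrow> nat \<Rightarrow> (nat \<Rightarrow> nat) \<Rightarrow> nat \<Rightarrow> nat \<Rightarrow> nat" where
  "Delta n r \<mu> q i =
     rev (sort (map (\<lambda>k. if k = q then new_entry n r \<mu> q else \<mu> k + delta n k) [1..<n + 1]))
       ! (i - 1)"

definition mu_q :: "nat \<Rightarrow> nat \<Rightarrow> (nat \<Rightarrow> nat) \<Rightarrow> nat \<Rightarrow> nat \<Rightarrow> nat" where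
  "mu_q n r \<mu> q i = (if i \<in> {1..n} then Delta n r \<mu> q i - delta n i else 0)"

definition collision :: "nat \<Rightarrow> nat \<Rightarrow> (nat \<Rightarrow> nat) \<Rightarrow> nat \<Rightarrow> bool" where
  "collision n r \<mu> q \<longleftrightarrow> (\<exists>j\<in>{1..n}. j \<noteq> q \<and> new_entry n r \<mu> q = \<mu> j + delta n j)"

definition p_index :: "nat \<Rightarrow> nat \<Rightarrow> (nat \<Rightarrow> nat) \<Rightarrow> nat \<Rightarrow> nat" where
  "p_index n r \<mu> q = (THE p. p \<in> {1..n} \<and> Delta n r \<mu> q p = new_entry n r \<mu> q)"

text \<open>In case of a collision \<open>\<Delta>\<^sub>q - \<delta>\<close> is not a partition (its entries may even be negative,
  which truncated subtraction hides), and the symplectic Schur polynomial is \<open>0\<close> by convention.\<close>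

definition sp_mu_q :: "nat \<Rightarrow> nat \<Rightarrow> (nat \<Rightarrow> 'a::field) \<Rightarrow> (nat \<Rightarrow> nat) \<Rightarrow> nat \<Rightarrow> 'a" where
  "sp_mu_q n r x \<mu> q = (if collision n r \<mu> q then 0 else sp n x (mu_q n r \<mu> q))"

section \<open>Indeterminates\<close>

text \<open>Rational functions over the integers in countably many commuting indeterminates: the inner
  mapping is a monomial (finitely supported exponents), the outer one a polynomial.\<close>

type_synonym rat_fun = "((nat \<Rightarrow>\<^sub>0 nat) \<Rightarrow>\<^sub>0 int) fract"

definition indet :: "nat \<Rightarrow> rat_fun" where
  "indet k = Fract (Poly_Mapping.single (Poly_Mapping.single k 1) 1) 1"

text \<open>\<open>x\<^sub>1, \<dots>, x\<^sub>n, y\<^sub>1, y\<^sub>2, \<dots>\<close> are the indeterminates number \<open>1, \<dots>, n, n + 1, n + 2, \<dots>\<close>.\<close>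

definition X :: "nat \<Rightarrow> rat_fun" where
  "X i = indet i"

definition Y :: "nat \<Rightarrow> nat \<Rightarrow> rat_fun" where
  "Y n j = indet (n + j)"

end

theory Submission
  imports Defs
begin

text \<open>
  Write a partition with at most \<open>N\<close> parts as the strictly decreasing sequence of its bead positions
  \<open>\<lambda>\<^sub>i + N - i\<close>.  Adding or removing a border strip with \<open>r\<close> boxes is then the same as moving one bead
  by \<open>r\<close> to a free position, and the height of the strip counts the beads jumped over
  (\<open>BS_imp_bead_move\<close>, \<open>bead_move_imp_BS\<close>).  Consequently, for every determinant whose columns depend
  on the beads, the sum over all ways to shift one bead by \<open>r\<close> is a signed sum over border strips
  (\<open>alternant_add_strip\<close>, \<open>alternant_remove_strip\<close>).  Such sums arise from the fact that replacing the
  rows of a matrix one at a time by the rows of another gives the same total as replacing the columns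
  one at a time (\<open>det1_sum_replace_row_eq_column\<close>).

  For the numerator of a symplectic Schur polynomial, the factor \<open>x\<^sup>r + x\<^sup>-\<^sup>r\<close> shifts an exponent by
  \<open>\<plusminus>r\<close>.  An exponent that becomes negative is reflected, since \<open>x\<^sup>a - x\<^sup>-\<^sup>a\<close> is odd in \<open>a\<close>; sorting the
  reflected exponents yields the partitions \<open>\<mu>\<^sup>(\<^sup>q\<^sup>)\<close> and their signs (\<open>power_sum_times_sp\<close>).

  The skew Schur polynomial of the conjugate shape counts chains of vertical strips, one for each
  variable (\<open>skew_schur_conj_eq_chain_weight\<close>).  A single vertical strip is a determinant with entries
  \<open>e\<^sub>k(y)\<close>, \<open>k = a\<^sub>i - b\<^sub>j\<close>, so that the same principle applies: raising \<open>a\<^sub>i\<close> is lowering \<open>b\<^sub>j\<close>.  Let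
  \<open>U\<close> and \<open>D\<close> denote the signed addition and removal of border strips, and \<open>W\<close> the matrix of chain
  weights.  Then \<open>D\<close> commutes with \<open>W\<close>, whereas the commutator of \<open>U\<close> and \<open>W\<close> is \<open>(-1)\<^bsup>r - 1\<^esup> p\<^sub>r(y) W\<close>,
  because the lowest beads cannot be lowered by \<open>r\<close> (\<open>chain_weight_remove_commute\<close>,
  \<open>chain_weight_add_commute\<close>).

  In the product of \<open>P\<^sub>r\<close> with an orthosymplectic Schur polynomial, the strips added to \<open>\<mu>\<close> by the
  \<open>x\<close>-part cancel against those that the \<open>y\<close>-part removes from \<open>\<mu>\<close>, and the three sums of the theorem
  remain (\<open>power_sum_times_spo\<close>).  All of this holds for arbitrary elements of a field, in particular
  for indeterminates.
\<close>

section \<open>Determinants and their columns\<close>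

lemma det1_leibniz:
  "det1 n a = (\<Sum>p | p permutes {0..<n}. signof p * (\<Prod>i = 0..<n. a (i + 1) (p i + 1)))"
proof -
  have "(\<Prod>i = 0..<n. mat n n (\<lambda>(i, j). a (i + 1) (j + 1)) $$ (i, p i)) =
        (\<Prod>i = 0..<n. a (i + 1) (p i + 1))" if "p permutes {0..<n}" for p
    using permutes_in_image[OF that] by (intro prod.cong refl) simp
  then show ?thesis
    unfolding det1_def by (subst det_def'[of _ n]) (auto intro!: sum.cong)
qed

lemma det1_cong:
  assumes "\<And>i j. i \<in> {1..n} \<Longrightarrow> j \<in> {1..n} \<Longrightarrow> a i j = b i j"
  shows "det1 n a = det1 n b"
  unfolding det1_def using assms by (intro arg_cong[where f = det] eq_matI) auto

lemma det1_transpose: "det1 n (\<lambda>i j. a j i) = det1 n a"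
proof -
  have "transpose_mat (mat n n (\<lambda>(i, j). a (i + 1) (j + 1))) =
        mat n n (\<lambda>(i, j). a (j + 1) (i + 1))"
    by (rule eq_matI) auto
  then show ?thesis
    unfolding det1_def using det_transpose[of "mat n n (\<lambda>(i, j). a (i + 1) (j + 1))" n] by simp
qed

lemma det1_equal_columns:
  assumes "j \<in> {1..n}" "k \<in> {1..n}" "j \<noteq> k" "\<And>i. i \<in> {1..n} \<Longrightarrow> a i j = a i k"
  shows "det1 n a = 0"
  unfolding det1_def
  by (rule det_identical_columns[of _ n "j - 1" "k - 1"])
     (use assms in \<open>auto intro!: eq_vecI\<close>)

lemma det1_swap_columns:
  assumes "j \<in> {1..n}" "k \<in> {1..n}" "j \<noteq> k"
  shows "det1 n (\<lambda>i l. a i (Transposition.transpose j k l)) = - det1 n a"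
proof -
  let ?A = "mat n n (\<lambda>(i, j). a (i + 1) (j + 1))"
  have "det (swapcols (j - 1) (k - 1) ?A) = - det ?A"
    using assms by (intro det_swapcols[of _ n]) auto
  moreover have "swapcols (j - 1) (k - 1) ?A =
      mat n n (\<lambda>(i, l). a (i + 1) (Transposition.transpose j k (l + 1)))"
    using assms by (intro eq_matI) (auto simp: Transposition.transpose_def)
  ultimately show ?thesis
    unfolding det1_def by simp
qed

definition replace_column :: "nat \<Rightarrow> (nat \<Rightarrow> 'a) \<Rightarrow> (nat \<Rightarrow> nat \<Rightarrow> 'a) \<Rightarrow> nat \<Rightarrow> nat \<Rightarrow> 'a" where
  "replace_column q t a = (\<lambda>i j. if j = q then t i else a i j)"

lemma det1_replace_column_leibniz:
  assumes "q \<in> {1..n}"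
  shows "det1 n (replace_column q t a) =
    (\<Sum>p | p permutes {0..<n}. signof p * (\<Sum>k = 0..<n. if p k + 1 = q then 
       t (k + 1) * (\<Prod>i \<in> {0..<n} - {k}. a (i + 1) (p i + 1)) else 0))"
proof -
  have "(\<Prod>i = 0..<n. replace_column q t a (i + 1) (p i + 1)) = 
      (\<Sum>k = 0..<n. if p k + 1 = q then 
         t (k + 1) * (\<Prod>i \<in> {0..<n} - {k}. a (i + 1) (p i + 1)) else 0)"
    if p: "p permutes {0..<n}" for p
  proof -
    define l where "l = inv_into UNIV p (q - 1)"
    have l: "p k + 1 = q \<longleftrightarrow> k = l" for k
      using permutes_inverses[OF p] assms by (force simp: l_def)
    have ln: "l \<in> {0..<n}"
      using permutes_in_image[OF permutes_inv[OF p], of "q - 1"] assms by (auto simp: l_def)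
    have "(\<Prod>i = 0..<n. replace_column q t a (i + 1) (p i + 1)) = 
      replace_column q t a (l + 1) (p l + 1) * 
      (\<Prod>i\<in>{0..<n} - {l}. replace_column q t a (i + 1) (p i + 1))"
      using ln by (subst prod.remove[of _ l]) auto
    also have "\<dots> = t (l + 1) * (\<Prod>i\<in>{0..<n} - {l}. a (i + 1) (p i + 1))"
      unfolding replace_column_def using l by (intro arg_cong2[where f = "(*)"] prod.cong) auto
    also have "\<dots> = (\<Sum>k = 0..<n. if k = l then 
         t (k + 1) * (\<Prod>i \<in> {0..<n} - {k}. a (i + 1) (p i + 1)) else 0)"
      using ln by (subst sum.delta) auto
    finally show ?thesis by (simp only: l)
  qed
  then show ?thesis
    unfolding det1_leibniz by (intro sum.cong refl) (simp del: sum.delta)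
qed

lemma det1_replace_column_add:
  assumes "q \<in> {1..n}"
  shows "det1 n (replace_column q (\<lambda>i. s i + t i) a) =
    det1 n (replace_column q s a) + det1 n (replace_column q t a)"
  unfolding det1_replace_column_leibniz[OF assms] sum.distrib[symmetric] distrib_left[symmetric]
  by (intro sum.cong refl arg_cong2[where f = "(*)"]) (simp add: distrib_right)

lemma det1_replace_column_scale:
  assumes "q \<in> {1..n}"
  shows "det1 n (replace_column q (\<lambda>i. c * t i) a) = c * det1 n (replace_column q t a)"
proof -
  have "c * det1 n (replace_column q t a) = (\<Sum>p | p permutes {0..<n}. signof p * 
    (\<Sum>k = 0..<n. c * (if p k + 1 = q then 
       t (k + 1) * (\<Prod>i \<in> {0..<n} - {k}. a (i + 1) (p i + 1)) else 0)))"
    unfolding det1_replace_column_leibniz[OF assms] 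
    by (simp add: sum_distrib_left mult.left_commute)
  also have "\<dots> = det1 n (replace_column q (\<lambda>i. c * t i) a)"
    unfolding det1_replace_column_leibniz[OF assms] 
    by (intro sum.cong refl arg_cong2[where f = "(*)"]) (simp add: mult.assoc)
  finally show ?thesis ..
qed

lemma det1_replace_column_sum:
  assumes "q \<in> {1..n}" "finite S"
  shows "det1 n (replace_column q (\<lambda>i. \<Sum>k\<in>S. t k i) a) = 
    (\<Sum>k\<in>S. det1 n (replace_column q (t k) a))"
  using assms(2)
proof (induction S rule: finite_induct)
  case empty
  show ?case using det1_replace_column_scale[OF assms(1), of 0 "\<lambda>_. 0" a] by simp
next
  case (insert k S)
  then show ?case by (simp add: det1_replace_column_add[OF assms(1)])
qed

text \<open>Both sides are the sum over all \<open>i\<close>, \<open>j\<close> of \<open>t i j\<close> times the cofactor of \<open>a\<close> at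
  \<open>(i, j)\<close>.  This is the engine of the whole development: a shift of the exponents that is
  natural along the rows of a determinant becomes a shift along its columns.\<close>

lemma det1_sum_replace_row_eq_column:
  "(\<Sum>k = 1..n. det1 n (\<lambda>i j. if i = k then t i j else a i j)) =
   (\<Sum>q = 1..n. det1 n (replace_column q (\<lambda>i. t i q) a))"
proof -
  define pr where "pr p k = t (k + 1) (p k + 1) * (\<Prod>i \<in> {0..<n} - {k}. a (i + 1) (p i + 1))"
    for p :: "nat \<Rightarrow> nat" and k
  have row: "det1 n (\<lambda>i j. if i = k then t i j else a i j) = 
      (\<Sum>p | p permutes {0..<n}. signof p * pr p (k - 1))" if "k \<in> {1..n}" for k
  proof -
    have "(\<Prod>i = 0..<n. if i + 1 = k then t (i + 1) (p i + 1) else a (i + 1) (p i + 1)) =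
       pr p (k - 1)" for p
    proof -
      have "(\<Prod>i = 0..<n. if i + 1 = k then t (i + 1) (p i + 1) else a (i + 1) (p i + 1)) =
        t k (p (k - 1) + 1) * (\<Prod>i\<in>{0..<n} - {k - 1}. 
          if i + 1 = k then t (i + 1) (p i + 1) else a (i + 1) (p i + 1))"
        using that by (subst prod.remove[of _ "k - 1"]) auto
      also have "(\<Prod>i\<in>{0..<n} - {k - 1}. 
          if i + 1 = k then t (i + 1) (p i + 1) else a (i + 1) (p i + 1)) = 
        (\<Prod>i \<in> {0..<n} - {k - 1}. a (i + 1) (p i + 1))"
        by (intro prod.cong) auto
      finally show ?thesis using that by (simp add: pr_def)
    qed
    then show ?thesis unfolding det1_leibniz by simp
  qed
  have "(\<Sum>k = 1..n. det1 n (\<lambda>i j. if i = k then t i j else a i j)) = 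
    (\<Sum>p | p permutes {0..<n}. signof p * (\<Sum>k = 1..n. pr p (k - 1)))"
    by (simp add: row sum_distrib_left) (rule sum.swap)
  also have "\<dots> = (\<Sum>p | p permutes {0..<n}. signof p * 
      (\<Sum>q = 1..n. \<Sum>k = 0..<n. if p k + 1 = q then pr p k else 0))"
  proof (rule sum.cong[OF refl], rule arg_cong2[where f = "(*)", OF refl])
    fix p assume "p \<in> {p. p permutes {0..<n}}"
    then have p: "p permutes {0..<n}" by simp
    have "(\<Sum>q = 1..n. \<Sum>k = 0..<n. if p k + 1 = q then pr p k else 0) = 
       (\<Sum>k = 0..<n. \<Sum>q = 1..n. if p k + 1 = q then pr p k else 0)"
      by (rule sum.swap)
    also have "\<dots> = (\<Sum>k = 0..<n. pr p k)"
      using permutes_in_image[OF p] by (intro sum.cong refl) (auto simp: Suc_le_eq)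
    also have "\<dots> = (\<Sum>k = 1..n. pr p (k - 1))"
      by (rule sum.reindex_bij_witness[of _ "\<lambda>k. k - 1" Suc]) auto
    finally show "(\<Sum>k = 1..n. pr p (k - 1)) = 
      (\<Sum>q = 1..n. \<Sum>k = 0..<n. if p k + 1 = q then pr p k else 0)" by simp
  qed
  also have "\<dots> = (\<Sum>q = 1..n. \<Sum>p | p permutes {0..<n}. signof p * 
      (\<Sum>k = 0..<n. if p k + 1 = q then pr p k else 0))"
    unfolding sum_distrib_left by (subst sum.swap) (rule refl)
  also have "\<dots> = (\<Sum>q = 1..n. det1 n (replace_column q (\<lambda>i. t i q) a))"
    by (intro sum.cong refl, subst det1_replace_column_leibniz)
       (auto simp: pr_def intro!: sum.cong arg_cong2[where f = "(*)"])
  finally show ?thesis .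
qed

text \<open>By the pigeonhole principle no permutation maps \<open>I\<close> into the smaller set \<open>J\<close>, so that every
  product in the Leibniz formula has a vanishing factor.\<close>

lemma det1_zero_block:
  assumes "I \<subseteq> {1..n}" "J \<subseteq> {1..n}" "card J < card I"
    and "\<And>i j. i \<in> I \<Longrightarrow> j \<in> {1..n} - J \<Longrightarrow> a i j = 0"
  shows "det1 n a = 0"
proof -
  have "(\<Prod>i = 0..<n. a (i + 1) (p i + 1)) = 0" if p: "p permutes {0..<n}" for p
  proof -
    have inj: "inj_on (\<lambda>i. p (i - 1) + 1) I"
    proof (rule inj_onI)
      fix i k assume "i \<in> I" "k \<in> I" "p (i - 1) + 1 = p (k - 1) + 1"
      then have "i - 1 = k - 1" "i \<ge> 1" "k \<ge> 1"
        using permutes_inj[OF p] assms(1) by (auto dest: injD)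
      then show "i = k" by simp
    qed
    have "\<not> (\<lambda>i. p (i - 1) + 1) ` I \<subseteq> J"
    proof
      assume "(\<lambda>i. p (i - 1) + 1) ` I \<subseteq> J"
      then have "card I \<le> card J"
        using inj assms(2) by (metis card_inj_on_le finite_atLeastAtMost finite_subset)
      then show False using assms(3) by simp
    qed
    then obtain i where i: "i \<in> I" "p (i - 1) + 1 \<notin> J" by auto
    have "i - 1 \<in> {0..<n}" using i(1) assms(1) by (force simp: subset_iff)
    moreover from this have "p (i - 1) \<in> {0..<n}" using permutes_in_image[OF p] by blast
    ultimately have "a (i - 1 + 1) (p (i - 1) + 1) = 0"
      using assms(1) assms(4)[of i "p (i - 1) + 1"] i by auto
    then show ?thesis using \<open>i - 1 \<in> {0..<n}\<close> by (intro prod_zero) auto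
  qed
  then show ?thesis unfolding det1_leibniz by simp
qed

text \<open>A permutation other than the identity has an inversion, and the hypothesis says that the two
  entries at an inversion are not both nonzero.\<close>

lemma det1_monotone_support:
  assumes "\<And>i k j l. i \<in> {1..n} \<Longrightarrow> k \<in> {1..n} \<Longrightarrow> j \<in> {1..n} \<Longrightarrow> l \<in> {1..n} \<Longrightarrow>
      i < k \<Longrightarrow> l < j \<Longrightarrow> a i j = 0 \<or> a k l = 0"
  shows "det1 n a = (\<Prod>i = 1..n. a i i)"
proof -
  have zero: "(\<Prod>i = 0..<n. a (i + 1) (p i + 1)) = 0" if p: "p permutes {0..<n}" "p \<noteq> id" for p
  proof -
    have "\<not> (\<forall>i k. i < k \<longrightarrow> k < n \<longrightarrow> p i < p k)"
    proof
      assume mono: "\<forall>i k. i < k \<longrightarrow> k < n \<longrightarrow> p i < p k"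
      \<comment> \<open>A strictly increasing permutation satisfies \<open>i \<le> p i\<close>; comparing sums forces equality.\<close>
      have ge: "i \<le> p i" if "i < n" for i
        using that
      proof (induction i)
        case (Suc i)
        have "p i < p (Suc i)" using mono Suc.prems by auto
        moreover have "i \<le> p i" using Suc by simp
        ultimately show ?case by linarith
      qed simp
      have "p i = i" if "i < n" for i
      proof (rule ccontr)
        assume "p i \<noteq> i"
        then have "(\<Sum>i = 0..<n. i) < (\<Sum>i = 0..<n. p i)"
          using ge that by (intro sum_strict_mono_ex1) (auto intro!: bexI[of _ i] simp: le_neq_trans)
        moreover have "(\<Sum>i = 0..<n. p i) = (\<Sum>i = 0..<n. i)"
          using sum.permute[OF p(1), of id] by (simp add: o_def)
        ultimately show False by simp
      qed
      moreover have "p i = i" if "\<not> i < n" for i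
        using p(1) that by (auto simp: permutes_def)
      ultimately show False using p(2) by (metis eq_id_iff)
    qed
    then obtain i k where ik: "i < k" "k < n" "\<not> p i < p k" by auto
    have "p i \<noteq> p k" using permutes_inj[OF p(1)] ik(1) by (auto dest: injD)
    then have "p k < p i" using ik by simp
    moreover have "p i < n" "p k < n" using permutes_in_image[OF p(1)] ik by auto
    ultimately have "a (i + 1) (p i + 1) = 0 \<or> a (k + 1) (p k + 1) = 0"
      using ik by (intro assms) auto
    then show ?thesis using ik
      by (intro prod_zero) auto
  qed
  have "det1 n a = (\<Sum>p \<in> {id}. signof p * (\<Prod>i = 0..<n. a (i + 1) (p i + 1)))"
    unfolding det1_leibniz 
    using zero by (intro sum.mono_neutral_right) (auto simp: permutes_id finite_permutations
        intro!: disjI2)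
  also have "\<dots> = (\<Prod>i = 0..<n. a (i + 1) (i + 1))" by simp
  also have "\<dots> = (\<Prod>i = 1..n. a i i)"
    by (rule prod.reindex_bij_witness[of _ "\<lambda>k. k - 1" Suc]) auto
  finally show ?thesis .
qed

section \<open>Alternants and moving one entry\<close>

text \<open>The exponents of the columns enter only through the family \<open>c\<close>, so that the numerators of the
  symplectic Schur polynomials and the Jacobi--Trudi-like determinants for vertical strips are
  covered at the same time, the latter both as functions of the outer and of the inner
  partition.\<close>

definition alternant :: "nat \<Rightarrow> (nat \<Rightarrow> 'b \<Rightarrow> 'a::comm_ring_1) \<Rightarrow> (nat \<Rightarrow> 'b) \<Rightarrow> 'a" where
  "alternant N g c = det1 N (\<lambda>i j. g i (c j))"

lemma alternant_cong:
  assumes "\<And>j. j \<in> {1..N} \<Longrightarrow> c j = d j"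
  shows "alternant N g c = alternant N g d"
  unfolding alternant_def by (rule det1_cong) (simp add: assms)

lemma alternant_collision:
  assumes "j \<in> {1..N}" "k \<in> {1..N}" "j \<noteq> k" "c j = c k"
  shows "alternant N g c = 0"
  unfolding alternant_def by (rule det1_equal_columns[of j N k]) (use assms in auto)

lemma alternant_swap:
  assumes "j \<in> {1..N}" "k \<in> {1..N}" "j \<noteq> k"
  shows "alternant N g (c \<circ> Transposition.transpose j k) = - alternant N g c"
  unfolding alternant_def using det1_swap_columns[OF assms, of "\<lambda>i j. g i (c j)"] by simp

lemma alternant_upd: "alternant N g (c(q := v)) = 
    det1 N (replace_column q (\<lambda>i. g i v) (\<lambda>i j. g i (c j)))"
  unfolding alternant_def replace_column_def by (rule det1_cong) auto

text \<open>The entry at position \<open>q\<close> is deleted and \<open>v\<close> is inserted so that it lands at position \<open>p\<close>; the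
  entries in between shift by one.\<close>

definition move_entry :: "nat \<Rightarrow> nat \<Rightarrow> 'b \<Rightarrow> (nat \<Rightarrow> 'b) \<Rightarrow> nat \<Rightarrow> 'b" where
  "move_entry q p v c i = 
     (if i = p then v else if p < i \<and> i \<le> q then c (i - 1)
      else if q \<le> i \<and> i < p then c (i + 1) else c i)"

text \<open>Moving the new entry from \<open>q\<close> to \<open>p\<close> takes \<open>\<bar>p - q\<bar>\<close> adjacent transpositions, each of which
  changes the sign.  The exponent \<open>p + q\<close> has the same parity and needs no case distinction.\<close>

lemma alternant_move_entry:
  assumes "q \<in> {1..N}" "p \<in> {1..N}"
  shows "alternant N g (move_entry q p v c) = (-1) ^ (p + q) * alternant N g (c(q := v))"
proof -
  have up: "p \<le> q \<Longrightarrow> p \<ge> 1 \<Longrightarrow> alternant N g (move_entry q p v c) = (-1) ^ (q - p) * alternant N g (c(q := v))"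
    for p
  proof (induction "q - p" arbitrary: p)
    case 0
    then have "p = q" by simp
    then have "move_entry q p v c = c(q := v)" by (auto simp: move_entry_def fun_eq_iff)
    then show ?case using \<open>p = q\<close> by simp
  next
    case (Suc d)
    have "move_entry q p v c = move_entry q (Suc p) v c \<circ> Transposition.transpose p (Suc p)"
      using Suc by (auto simp: move_entry_def fun_eq_iff Transposition.transpose_def)
    then have "alternant N g (move_entry q p v c) = - alternant N g (move_entry q (Suc p) v c)"
      using Suc(2-4) assms by (simp only:) (rule alternant_swap, auto)
    moreover have "q - p = Suc (q - Suc p)" using Suc by simp
    ultimately show ?case using Suc by simp
  qed
  have down: "q \<le> p \<Longrightarrow> p \<le> N \<Longrightarrow> alternant N g (move_entry q p v c) = (-1) ^ (p - q) * alternant N g (c(q := v))"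
    for p
  proof (induction "p - q" arbitrary: p)
    case 0
    then have "p = q" by simp
    then have "move_entry q p v c = c(q := v)" by (auto simp: move_entry_def fun_eq_iff)
    then show ?case using \<open>p = q\<close> by simp
  next
    case (Suc d)
    from Suc obtain p' where p': "p = Suc p'" "q \<le> p'" by (cases p) auto
    then have "move_entry q p v c = move_entry q (p - 1) v c \<circ> Transposition.transpose p (p - 1)"
      by (auto simp: move_entry_def fun_eq_iff Transposition.transpose_def)
    then have "alternant N g (move_entry q p v c) = - alternant N g (move_entry q (p - 1) v c)"
      using Suc(2-4) assms by (simp only:) (rule alternant_swap, auto)
    moreover have "alternant N g (move_entry q (p - 1) v c) = 
        (-1) ^ (p - 1 - q) * alternant N g (c(q := v))"
      using p' Suc.hyps(2) Suc.prems by (intro Suc.hyps(1)) auto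
    ultimately show ?case using p' by (simp add: Suc_diff_le)
  qed
  show ?thesis
  proof (cases "p \<le> q")
    case True
    then have "q + p = (q - p) + 2 * p" by simp
    then have "(-1 :: 'a) ^ (q + p) = (-1) ^ (q - p + 2 * p)" by (rule arg_cong)
    then have "(-1 :: 'a) ^ (q + p) = (-1) ^ (q - p)" by (simp add: power_add power_mult)
    then show ?thesis using up[OF True] assms by (simp add: add.commute)
  next
    case False
    then have "p + q = (p - q) + 2 * q" by simp
    then have "(-1 :: 'a) ^ (p + q) = (-1) ^ (p - q + 2 * q)" by (rule arg_cong)
    then have "(-1 :: 'a) ^ (p + q) = (-1) ^ (p - q)" by (simp add: power_add power_mult)
    then show ?thesis using down[of p] assms False by simp
  qed
qed

definition decreasing :: "nat \<Rightarrow> (nat \<Rightarrow> nat) \<Rightarrow> bool" where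
  "decreasing N c \<longleftrightarrow> (\<forall>i j. 1 \<le> i \<longrightarrow> i < j \<longrightarrow> j \<le> N \<longrightarrow> c j < c i)"

lemma decreasingD: "decreasing N c \<Longrightarrow> 1 \<le> i \<Longrightarrow> i < j \<Longrightarrow> j \<le> N \<Longrightarrow> c j < c i"
  by (auto simp: decreasing_def)

lemma decreasing_le_imp:
  "decreasing N c \<Longrightarrow> i \<in> {1..N} \<Longrightarrow> j \<in> {1..N} \<Longrightarrow> c i \<le> c j \<Longrightarrow> j \<le> i"
  by (metis atLeastAtMost_iff decreasingD not_le)

lemma decreasingI_Suc:
  assumes "\<And>i. 1 \<le> i \<Longrightarrow> i < N \<Longrightarrow> c (Suc i) < c i"
  shows "decreasing N c"
proof -
  have "1 \<le> i \<Longrightarrow> i < j \<Longrightarrow> j \<le> N \<Longrightarrow> c j < c i" for i j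
  proof (induction j)
    case (Suc j)
    then show ?case using assms[of j] by (cases "i = j") (auto intro: less_trans)
  qed simp
  then show ?thesis by (auto simp: decreasing_def)
qed

text \<open>The landing position is the first entry that is at most \<open>v\<close>.  With the next lemma, which treats
  \<open>v \<le> c q\<close>, this covers every new entry that does not collide with one of the others.\<close>

lemma decreasing_move_up:
  assumes c: "decreasing N c" and q: "q \<in> {1..N}" and v: "v \<notin> c ` ({1..N} - {q})" "c q \<le> v"
  obtains p where "p \<in> {1..q}" "decreasing N (move_entry q p v c)"
proof -
  define p where "p = (LEAST i. 1 \<le> i \<and> c i \<le> v)"
  have p: "1 \<le> p" "c p \<le> v" 
    using LeastI[of "\<lambda>i. 1 \<le> i \<and> c i \<le> v" q] q v by (auto simp: p_def)
  have pq: "p \<le> q" using q v unfolding p_def by (intro Least_le) auto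
  have lt: "v < c i" if "1 \<le> i" "i < p" for i
    using not_less_Least[of i "\<lambda>i. 1 \<le> i \<and> c i \<le> v"] that by (auto simp: p_def)
  have gt: "c i < v" if "p \<le> i" "i \<le> N" "i \<noteq> q" for i
  proof -
    have "c i \<le> v" using decreasingD[OF c, of p i] p that by (cases "i = p") auto
    moreover have "c i \<noteq> v" using v that p by auto
    ultimately show ?thesis by simp
  qed
  have "decreasing N (move_entry q p v c)"
  proof (rule decreasingI_Suc)
    fix i assume i: "1 \<le> i" "i < N"
    show "move_entry q p v c (Suc i) < move_entry q p v c i"
      using i pq q p lt[of i] gt[of i] gt[of "Suc i"] decreasingD[OF c, of i "Suc i"] 
        decreasingD[OF c, of "i - 1" i] decreasingD[OF c, of "i - 1" "Suc i"]
      unfolding move_entry_def by (auto split: if_splits)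
  qed
  then show ?thesis using that[of p] p pq by auto
qed

lemma decreasing_move_down:
  assumes c: "decreasing N c" and q: "q \<in> {1..N}" and v: "v \<notin> c ` ({1..N} - {q})" "v \<le> c q"
  obtains p where "p \<in> {q..N}" "decreasing N (move_entry q p v c)"
proof -
  define p where "p = Max {i\<in>{1..N}. v \<le> c i}"
  have "p \<in> {i\<in>{1..N}. v \<le> c i}"
    unfolding p_def by (rule Max_in) (use q v in auto)
  then have p: "1 \<le> p" "p \<le> N" "v \<le> c p" by auto
  have pq: "q \<le> p" using q v unfolding p_def by (intro Max_ge) auto
  have lt: "c i < v" if "p < i" "i \<le> N" for i
  proof (rule ccontr)
    assume "\<not> c i < v"
    then have "i \<le> p" unfolding p_def using that by (intro Max_ge) auto
    then show False using that by simp
  qed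
  have gt: "v < c i" if "1 \<le> i" "i \<le> p" "i \<noteq> q" for i
  proof -
    have "v \<le> c i" using decreasingD[OF c, of i p] p that by (cases "i = p") auto
    moreover have "c i \<noteq> v" using v that p by auto
    ultimately show ?thesis by simp
  qed
  have "decreasing N (move_entry q p v c)"
  proof (rule decreasingI_Suc)
    fix i assume i: "1 \<le> i" "i < N"
    show "move_entry q p v c (Suc i) < move_entry q p v c i"
      using i pq q p lt[of "Suc i"] gt[of i] gt[of "Suc i"] decreasingD[OF c, of i "Suc i"] 
        decreasingD[OF c, of "Suc i" "Suc (Suc i)"] decreasingD[OF c, of "i" "Suc (Suc i)"]
      unfolding move_entry_def by (auto split: if_splits)
  qed
  then show ?thesis using that[of p] p pq by auto
qed


section \<open>Partitions as bead positions\<close>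

lemma partition_0: "is_partition l \<Longrightarrow> l 0 = 0"
  and partition_Suc: "is_partition l \<Longrightarrow> 1 \<le> i \<Longrightarrow> l (Suc i) \<le> l i"
  by (simp_all add: is_partition_def)

lemma partition_antimono: "is_partition l \<Longrightarrow> 1 \<le> i \<Longrightarrow> i \<le> j \<Longrightarrow> l j \<le> l i"
proof (induction j)
  case (Suc j)
  then show ?case
    using partition_Suc[of l j] by (cases "i = Suc j") (auto intro: order_trans)
qed simp

lemma num_parts_le_iff:
  assumes "is_partition l"
  shows "num_parts l \<le> N \<longleftrightarrow> (\<forall>i>N. l i = 0)"
proof
  assume le: "num_parts l \<le> N"
  show "\<forall>i>N. l i = 0"
  proof (intro allI impI, rule ccontr)
    fix i assume i: "i > N" "l i \<noteq> 0"
    have "{1..i} \<subseteq> {i. l i \<noteq> 0}"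
    proof
      fix k assume "k \<in> {1..i}"
      then show "k \<in> {i. l i \<noteq> 0}" 
        using partition_antimono[OF assms, of k i] i by auto
    qed
    moreover have "finite {i. l i \<noteq> 0}" using assms by (simp add: is_partition_def)
    ultimately have "card {1..i} \<le> num_parts l" unfolding num_parts_def by (rule card_mono[rotated])
    then show False using le i by simp
  qed
next
  assume "\<forall>i>N. l i = 0"
  moreover have "l 0 = 0" using assms by (simp add: is_partition_def)
  ultimately have "{i. l i \<noteq> 0} \<subseteq> {1..N}"
    by (smt (verit) atLeastAtMost_iff less_one mem_Collect_eq not_le subsetI) 
  then have "num_parts l \<le> card {1..N}" unfolding num_parts_def by (intro card_mono) auto
  then show "num_parts l \<le> N" by simp
qed

lemma diagram_subset_iff: 
  assumes "is_partition l" 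
  shows "diagram l \<subseteq> diagram e \<longleftrightarrow> (\<forall>i. l i \<le> e i)"
proof
  assume sub: "diagram l \<subseteq> diagram e"
  show "\<forall>i. l i \<le> e i"
  proof
    fix i show "l i \<le> e i"
    proof (cases "i \<ge> 1 \<and> l i \<ge> 1")
      case True
      then have "(i, l i) \<in> diagram l" by (simp add: diagram_def)
      then show ?thesis using sub by (auto simp: diagram_def)
    next
      case False
      then have "l i = 0" using assms by (cases i) (auto simp: is_partition_def)
      then show ?thesis by simp
    qed
  qed
qed (auto simp: diagram_def intro: order_trans)

text \<open>On the positions \<open>1, \<dots>, N\<close> a partition with at most \<open>N\<close> parts becomes a strictly decreasing
  sequence of bead positions \<open>\<lambda>\<^sub>i + N - i\<close>, and every such sequence arises in this way.\<close>

definition beads :: "nat \<Rightarrow> (nat \<Rightarrow> nat) \<Rightarrow> nat \<Rightarrow> nat" where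
  "beads N l i = l i + (N - i)"

lemma decreasing_beads: "is_partition l \<Longrightarrow> decreasing N (beads N l)"
  unfolding beads_def
  by (rule decreasingI_Suc, rule add_le_less_mono) (auto intro: partition_Suc)

definition of_beads :: "nat \<Rightarrow> (nat \<Rightarrow> nat) \<Rightarrow> nat \<Rightarrow> nat" where
  "of_beads N d i = (if i \<in> {1..N} then d i - (N - i) else 0)"

lemma decreasing_ge:
  assumes "decreasing N d" "i \<in> {1..N}"
  shows "N - i + d N \<le> d i"
proof -
  have "1 \<le> i \<Longrightarrow> i + k = N \<Longrightarrow> k + d N \<le> d i" for k i
  proof (induction k arbitrary: i)
    case (Suc k)
    then have "k + d N \<le> d (Suc i)" by simp
    moreover have "d (Suc i) < d i" using Suc.prems by (intro decreasingD[OF assms(1)]) auto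
    ultimately show ?case by simp
  qed simp
  from this[of i "N - i"] show ?thesis using assms by simp
qed

lemma of_beads:
  assumes "decreasing N d"
  shows "is_partition (of_beads N d)" "num_parts (of_beads N d) \<le> N"
    "\<And>i. i \<in> {1..N} \<Longrightarrow> beads N (of_beads N d) i = d i"
proof -
  have "finite {i. of_beads N d i \<noteq> 0}"
    by (rule finite_subset[of _ "{1..N}"]) (auto simp: of_beads_def)
  moreover have "of_beads N d (Suc i) \<le> of_beads N d i" if "i \<ge> 1" for i
    using that decreasingD[OF assms, of i "Suc i"] 
    by (auto simp: of_beads_def)
  ultimately show *: "is_partition (of_beads N d)" 
    by (auto simp: is_partition_def of_beads_def)
  show "num_parts (of_beads N d) \<le> N"
    using num_parts_le_iff[OF *] by (auto simp: of_beads_def)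
  show "beads N (of_beads N d) i = d i" if "i \<in> {1..N}" for i
    using that decreasing_ge[OF assms that] by (auto simp: of_beads_def beads_def)
qed

text \<open>The row form of a bead move: the bead of row \<open>q\<close> jumps \<open>r\<close> places up and becomes the bead of
  row \<open>p\<close>.  The rows in between receive the part of the row above them, plus one.  The relation is
  stated with parts instead of beads so that it does not depend on the number \<open>N\<close> of beads.\<close>

definition bead_move :: "nat \<Rightarrow> nat \<Rightarrow> nat \<Rightarrow> (nat \<Rightarrow> nat) \<Rightarrow> (nat \<Rightarrow> nat) \<Rightarrow> bool" where
  "bead_move p q r l e \<longleftrightarrow> 1 \<le> p \<and> p \<le> q \<and> e p + q = l q + r + p \<and>
     (\<forall>i. p < i \<and> i \<le> q \<longrightarrow> e i = l (i - 1) + 1) \<and> (\<forall>i. i < p \<or> q < i \<longrightarrow> e i = l i)"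

lemma bead_moveD:
  assumes "bead_move p q r l e"
  shows "1 \<le> p" "p \<le> q" "e p + q = l q + r + p"
    "\<And>i. p < i \<Longrightarrow> i \<le> q \<Longrightarrow> e i = l (i - 1) + 1"
    "\<And>i. i < p \<Longrightarrow> e i = l i" "\<And>i. q < i \<Longrightarrow> e i = l i"
  using assms unfolding bead_move_def by blast+

lemma bead_move_less:
  assumes "is_partition l" "is_partition e" "r \<ge> 1" "bead_move p q r l e"
  shows "l i < e i \<longleftrightarrow> i \<in> {p..q}"
proof -
  note bm = bead_moveD[OF assms(4)]
  have inner: "l i < e i" if "p < i" "i \<le> q" for i
  proof -
    have "1 \<le> i - 1" using that bm(1) by linarith
    then show ?thesis using partition_antimono[OF assms(1), of "i - 1" i] bm(4)[OF that] by simp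
  qed
  have first: "l p < e p"
  proof (cases "p = q")
    case True
    then show ?thesis using bm(3) assms(3) by simp
  next
    case False
    then have "e (Suc p) = l p + 1" using bm(2) bm(4)[of "Suc p"] by simp
    moreover have "e (Suc p) \<le> e p" using bm(1) by (intro partition_Suc assms)
    ultimately show ?thesis by simp
  qed
  consider "i < p" | "i = p" | "p < i \<and> i \<le> q" | "q < i" by linarith
  then show ?thesis
    using inner[of i] first bm(2) bm(5,6)[of i] by cases auto
qed

lemma bead_move_le:
  assumes "is_partition l" "is_partition e" "r \<ge> 1" "bead_move p q r l e"
  shows "l i \<le> e i"
proof (cases "i \<in> {p..q}")
  case True
  then show ?thesis using bead_move_less[OF assms, of i] by simp
next
  case False
  then have "e i = l i" using bead_moveD(5,6)[OF assms(4), of i] by auto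
  then show ?thesis by simp
qed

text \<open>In terms of beads, the bead at position \<open>q\<close> is replaced by itself plus \<open>r\<close> and then sorted in at
  position \<open>p\<close>.\<close>

lemma bead_move_beads:
  assumes "num_parts l \<le> N" "num_parts e \<le> N" "is_partition l" "is_partition e" "q \<le> N" "1 \<le> p" "p \<le> q"
  shows "bead_move p q r l e \<longleftrightarrow> 
    (\<forall>i\<in>{1..N}. beads N e i = move_entry q p (beads N l q + r) (beads N l) i)"
proof
  assume "bead_move p q r l e"
  note bm = bead_moveD[OF this]
  show "\<forall>i\<in>{1..N}. beads N e i = move_entry q p (beads N l q + r) (beads N l) i"
  proof
    fix i assume i: "i \<in> {1..N}"
    consider "i < p" | "i = p" | "p < i \<and> i \<le> q" | "q < i" by linarith
    then show "beads N e i = move_entry q p (beads N l q + r) (beads N l) i"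
      using bm(1-3) bm(4-6)[of i] i assms(5-7) by cases (auto simp: beads_def move_entry_def)
  qed
next
  assume *: "\<forall>i\<in>{1..N}. beads N e i = move_entry q p (beads N l q + r) (beads N l) i"
  have "e p + q = l q + r + p" 
    using *[rule_format, of p] assms by (auto simp: beads_def move_entry_def)
  moreover have "e i = l (i - 1) + 1" if "p < i" "i \<le> q" for i
    using *[rule_format, of i] assms that by (auto simp: beads_def move_entry_def)
  moreover have "e i = l i" if "i < p \<or> q < i" for i
  proof (cases "i \<in> {1..N}")
    case True
    then show ?thesis using *[rule_format, of i] assms that 
      by (auto simp: beads_def move_entry_def split: if_splits)
  next
    case False
    then have "i = 0 \<or> i > N" by auto
    then show ?thesis using assms num_parts_le_iff[of l N] num_parts_le_iff[of e N]
      by (auto simp: partition_0)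
  qed
  ultimately show "bead_move p q r l e" using assms by (auto simp: bead_move_def)
qed

text \<open>The landing row is forced, because the beads of a partition are sorted: of two different
  candidate rows, the upper one would hold a bead that is too small.\<close>

lemma bead_move_unique_target:
  assumes "is_partition l" "is_partition e" "is_partition e'"
    "bead_move p q r l e" "bead_move p' q r l e'"
  shows "e = e'"
proof -
  have aux: "p' \<le> p" if e: "is_partition e" "is_partition e'"
    and 1: "bead_move p q r l e" and 2: "bead_move p' q r l e'" for p p' e e'
  proof (rule ccontr)
    note 1 = bead_moveD[OF 1] and 2 = bead_moveD[OF 2]
    assume "\<not> p' \<le> p"
    then have lt: "p < p'" by simp
    have "e (Suc p) = l p + 1" using 1(4)[of "Suc p"] 2(2) lt by simp
    moreover have "e' p = l p" using 2(5) lt by simp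
    moreover have "e (Suc p) \<le> e p" using partition_Suc[OF e(1)] 1(1) by blast
    moreover have "e' p' \<le> e' p" using partition_antimono[OF e(2), of p p'] 1(1) lt by simp
    ultimately show False using lt 1(3) 2(3) by linarith
  qed
  have eq: "p = p'" using aux[of e e' p p'] aux[of e' e p' p] assms by simp
  note 1 = bead_moveD[OF assms(4)] and 2 = bead_moveD[OF assms(5), folded eq]
  have "e i = e' i" for i
  proof -
    consider "i < p" | "i = p" | "p < i \<and> i \<le> q" | "q < i" by linarith
    then show ?thesis using 1(3) 1(4-6)[of i] 2(3) 2(4-6)[of i] by cases auto
  qed
  then show ?thesis by auto
qed

lemma bead_move_unique_source:
  assumes "is_partition l" "is_partition l'" "is_partition e"
    "bead_move p q r l e" "bead_move p q' r l' e"
  shows "l = l'"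
proof -
  have aux: "q \<le> q'" if l: "is_partition l" "is_partition l'"
    and 1: "bead_move p q r l e" and 2: "bead_move p q' r l' e" for q q' l l'
  proof (rule ccontr)
    note 1 = bead_moveD[OF 1] and 2 = bead_moveD[OF 2]
    assume "\<not> q \<le> q'"
    then have lt: "q' < q" by simp
    have "e q = l (q - 1) + 1" using 1(4)[of q] 2(2) lt by simp
    moreover have "e q = l' q" using 2(6) lt by simp
    moreover have "l q \<le> l (q - 1)" using partition_antimono[OF l(1), of "q - 1" q] 2(1,2) lt by simp
    moreover have "l' q \<le> l' q'" using partition_antimono[OF l(2), of q' q] 2(1,2) lt by simp
    ultimately show False using lt 1(3) 2(3) by linarith
  qed
  have eq: "q = q'" using aux[of l l' q q'] aux[of l' l q' q] assms by simp
  note 1 = bead_moveD[OF assms(4)] and 2 = bead_moveD[OF assms(5), folded eq]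
  have "l i = l' i" for i
  proof -
    consider "i < p" | "i = q" | "p \<le> i \<and> i < q" | "q < i" by linarith
    then show ?thesis using 1(3) 1(4)[of "Suc i"] 1(5,6)[of i] 2(3) 2(4)[of "Suc i"] 2(5,6)[of i]
      by cases auto
  qed
  then show ?thesis by auto
qed

section \<open>Border strips as bead moves\<close>

lemma mem_skew: "(i, j) \<in> skew e l \<longleftrightarrow> 1 \<le> i \<and> l i < j \<and> j \<le> e i"
  by (auto simp: skew_def diagram_def)

lemma skew_eq_Sigma: 
  assumes "is_partition e" 
  shows "skew e l = (SIGMA i:{i. l i < e i}. {l i<..e i})"
proof -
  have "1 \<le> i" if "l i < j" "j \<le> e i" for i j 
    using that partition_0[OF assms] by (cases i) auto
  then show ?thesis by (auto simp: mem_skew)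
qed

lemma fst_skew: "is_partition e \<Longrightarrow> fst ` skew e l = {i. l i < e i}"
  by (force simp: skew_eq_Sigma)

lemma finite_support_diff: "is_partition e \<Longrightarrow> finite {i. l i < e i}"
  by (rule finite_subset[of _ "{i. e i \<noteq> 0}"]) (auto simp: is_partition_def)

lemma finite_skew: "is_partition e \<Longrightarrow> finite (skew e l)"
  by (simp add: skew_eq_Sigma finite_support_diff)

lemma card_skew: "is_partition e \<Longrightarrow> card (skew e l) = (\<Sum>i | l i < e i. e i - l i)"
  by (simp add: skew_eq_Sigma finite_support_diff)

lemma is_skew_diagram_skew:
  "is_partition l \<Longrightarrow> is_partition e \<Longrightarrow> (\<And>i. l i \<le> e i) \<Longrightarrow> is_skew_diagram (skew e l)"
  unfolding is_skew_diagram_def using diagram_subset_iff by blast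

lemma share_side_sym: "share_side a b \<longleftrightarrow> share_side b a"
  by (cases a; cases b) auto

text \<open>The numbers of boxes in the rows telescope, since each row but the first ends one column to the
  right of where the inner partition ends in the row above.\<close>

lemma card_skew_rows:
  assumes e: "is_partition e" "1 \<le> p" "p \<le> q"
    and rows: "\<And>i. l i < e i \<longleftrightarrow> i \<in> {p..q}"
    and mid: "\<And>i. p < i \<Longrightarrow> i \<le> q \<Longrightarrow> e i = l (i - 1) + 1"
  shows "card (skew e l) + l q + p = e p + q"
proof -
  have *: "p \<le> q \<Longrightarrow> (\<And>i. p \<le> i \<Longrightarrow> i \<le> q \<Longrightarrow> l i < e i) \<Longrightarrow> 
      (\<And>i. p < i \<Longrightarrow> i \<le> q \<Longrightarrow> e i = l (i - 1) + 1) \<Longrightarrow>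
      (\<Sum>i = p..q. e i - l i) + l q + p = e p + q" for q
  proof (induction q rule: dec_induct)
    case base
    show ?case using base(1)[of p] by simp
  next
    case (step q)
    have "(\<Sum>i = p..q. e i - l i) + l q + p = e p + q" 
      using step.prems by (intro step.IH) auto
    moreover have "e (Suc q) = l q + 1" using step.prems(2)[of "Suc q"] step.hyps by simp
    moreover have "l (Suc q) < e (Suc q)" using step.prems(1)[of "Suc q"] step.hyps by simp
    ultimately show ?case using step.hyps by simp
  qed
  have "(\<Sum>i = p..q. e i - l i) + l q + p = e p + q" 
  proof (rule *[OF e(3)])
    show "l i < e i" if "p \<le> i" "i \<le> q" for i using rows[of i] that by simp
    show "e i = l (i - 1) + 1" if "p < i" "i \<le> q" for i using mid[OF that] .
  qed
  moreover have "{i. l i < e i} = {p..q}" using rows by blast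
  ultimately show ?thesis using card_skew[OF e(1)] by simp
qed

text \<open>Consecutive rows of a border strip overlap in exactly one column.  If row \<open>i\<close> reached further
  right than \<open>l (i - 1) + 1\<close>, there would be a two-by-two block; if it ended earlier, no step could
  lead from the rows \<open>\<ge> i\<close> to the rows above, contradicting connectedness.\<close>

lemma BS_imp_bead_move:
  assumes l: "is_partition l" and e: "is_partition e" and le: "\<And>i. l i \<le> e i" 
    and BS: "skew e l \<in> BS r"
  obtains p q where "bead_move p q r l e"
proof -
  define S where "S = skew e l"
  define R where "R = {i. l i < e i}"
  have S: "S \<noteq> {}" "boxes_connected S" "card S = r"
    "\<not> (\<exists>i j. {(i, j), (Suc i, j), (i, Suc j), (Suc i, Suc j)} \<subseteq> S)"
    using BS by (auto simp: BS_def border_strip_def S_def)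
  have R: "finite R" "R \<noteq> {}" 
    using finite_support_diff[OF e] S(1) skew_eq_Sigma[OF e] by (auto simp: R_def S_def)
  define p where "p = Min R"
  define q where "q = Max R"
  have pq: "p \<in> R" "q \<in> R" "p \<le> q" "\<And>i. i \<in> R \<Longrightarrow> p \<le> i \<and> i \<le> q"
    using R by (auto simp: p_def q_def)
  have p1: "1 \<le> p" using pq(1) partition_0[OF e] by (cases p) (auto simp: R_def)
  have mid: "e i = l (i - 1) + 1" if i: "p < i" "i \<le> q" for i
  proof (rule ccontr)
    assume neq: "e i \<noteq> l (i - 1) + 1"
    obtain k where k: "i = Suc k" "1 \<le> k" using i p1 by (cases i) auto
    have mono: "l (Suc k) \<le> l k" "e (Suc k) \<le> e k" 
      using partition_Suc[OF l k(2)] partition_Suc[OF e k(2)] .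
    consider "l k + 2 \<le> e (Suc k)" | "e (Suc k) \<le> l k" using neq k by force
    then show False
    proof cases
      case 1
      have "{(k, Suc (l k)), (Suc k, Suc (l k)), (k, Suc (Suc (l k))), (Suc k, Suc (Suc (l k)))} \<subseteq> S"
        using 1 mono k(2) unfolding S_def by (simp add: mem_skew)
      then show False using S(4) by blast
    next
      case 2
      have step: "i \<le> fst b" if "a \<in> S" "b \<in> S" "share_side a b" "i \<le> fst a" for a b
      proof (rule ccontr)
        assume "\<not> i \<le> fst b"
        then have lt: "fst b \<le> k" "Suc k \<le> fst a" using that(4) k by auto
        obtain a1 j b1 j' where ab: "a = (a1, j)" "b = (b1, j')" by (cases a; cases b)
        then have "a1 = Suc k" "b1 = k" "j' = j" using lt that(3) by auto
        then show False using that(1,2) 2 ab unfolding S_def by (simp add: mem_skew)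
      qed
      have "(q, e q) \<in> S" "(p, e p) \<in> S" 
        using pq(1-3) p1 unfolding S_def R_def by (auto simp: mem_skew)
      then have "((q, e q), (p, e p)) \<in> {(c, d). c \<in> S \<and> d \<in> S \<and> share_side c d}\<^sup>*"
        using S(2) unfolding boxes_connected_def by blast
      then have "i \<le> fst (p, e p)"
        by (induction rule: rtrancl_induct) (use i step in auto)
      then show False using i by simp
    qed
  qed
  have rows: "l i < e i \<longleftrightarrow> i \<in> {p..q}" for i
  proof
    show "l i < e i \<Longrightarrow> i \<in> {p..q}" using pq(4)[of i] by (auto simp: R_def)
  next
    assume i: "i \<in> {p..q}"
    show "l i < e i"
    proof (cases "i = p")
      case True
      then show ?thesis using pq by (simp add: R_def)
    next
      case False
      then have "e i = l (i - 1) + 1" using i by (intro mid) auto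
      moreover have "l i \<le> l (i - 1)" 
      proof -
        have "1 \<le> i - 1" using i False p1 by simp linarith
        then show ?thesis using partition_antimono[OF l, of "i - 1" i] by simp
      qed
      ultimately show ?thesis by simp
    qed
  qed
  have "r + l q + p = e p + q"
    using card_skew_rows[OF e p1 pq(3) rows mid] S(3) by (simp add: S_def)
  moreover have "e i = l i" if "i < p \<or> q < i" for i
    using rows[of i] le[of i] that by auto
  ultimately have "bead_move p q r l e" 
    unfolding bead_move_def using p1 pq(3) mid by simp
  then show ?thesis using that by blast
qed

text \<open>For connectedness, each box is joined to the first box of the lowest row: walk left to the start
  of the row, step down through the single column shared with the next row, and repeat.\<close>

lemma bead_move_imp_BS:
  assumes l: "is_partition l" and e: "is_partition e" and r: "r \<ge> 1" and bm: "bead_move p q r l e"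
  shows "skew e l \<in> BS r" "ht (skew e l) = q - p"
proof -
  note D = bead_moveD[OF bm]
  note rows = bead_move_less[OF l e r bm]
  define S where "S = skew e l"
  have S: "(i, j) \<in> S \<longleftrightarrow> l i < j \<and> j \<le> e i" for i j
    using rows[of i] D(1) by (auto simp: S_def mem_skew)
  have "card S = r"
    using card_skew_rows[OF e D(1,2) rows D(4)] D(3) by (simp add: S_def)
  moreover have "S \<noteq> {}" using \<open>card S = r\<close> r by auto
  moreover have "\<not> (\<exists>i j. {(i, j), (Suc i, j), (i, Suc j), (Suc i, Suc j)} \<subseteq> S)"
  proof
    assume "\<exists>i j. {(i, j), (Suc i, j), (i, Suc j), (Suc i, Suc j)} \<subseteq> S"
    then obtain i j where ij: "l i < j" "Suc j \<le> e (Suc i)" "l i < e i" "l (Suc i) < e (Suc i)"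
      by (force simp: S)
    then have "p < Suc i" "Suc i \<le> q" using rows[of i] rows[of "Suc i"] by auto
    then have "e (Suc i) = l i + 1" using D(4)[of "Suc i"] by simp
    then show False using ij by simp
  qed
  moreover have "boxes_connected S"
  proof -
    define A where "A = {(c, d). c \<in> S \<and> d \<in> S \<and> share_side c d}"
    have left: "((i, Suc (l i) + k), (i, Suc (l i))) \<in> A\<^sup>*" if "(i, Suc (l i) + k) \<in> S" for i k
      using that
    proof (induction k)
      case (Suc k)
      then have "(i, Suc (l i) + k) \<in> S" by (auto simp: S)
      then have "((i, Suc (l i) + Suc k), (i, Suc (l i) + k)) \<in> A" 
        using Suc.prems by (simp add: A_def)
      then show ?case using Suc.IH[OF \<open>(i, Suc (l i) + k) \<in> S\<close>] by (rule converse_rtrancl_into_rtrancl)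
    qed simp
    have row: "((i, j), (i, Suc (l i))) \<in> A\<^sup>*" if "(i, j) \<in> S" for i j
      using left[of i "j - Suc (l i)"] that by (auto simp: S)
    have down: "((q - k, Suc (l (q - k))), (q, Suc (l q))) \<in> A\<^sup>*" if "p + k \<le> q" for k
      using that
    proof (induction k)
      case (Suc k)
      define i where "i = q - Suc k"
      have i: "p \<le> i" "Suc i \<le> q" "q - k = Suc i" using Suc.prems by (auto simp: i_def)
      have 1: "(i, Suc (l i)) \<in> S" using i rows[of i] by (auto simp: S)
      have 2: "(Suc i, Suc (l i)) \<in> S" 
        using i rows[of "Suc i"] D(4)[of "Suc i"] by (auto simp: S)
      have "((i, Suc (l i)), (Suc i, Suc (l i))) \<in> A" using 1 2 by (auto simp: A_def)
      moreover have "((Suc i, Suc (l i)), (Suc i, Suc (l (Suc i)))) \<in> A\<^sup>*" using row[OF 2] .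
      moreover have "((Suc i, Suc (l (Suc i))), (q, Suc (l q))) \<in> A\<^sup>*" 
        using Suc i by simp
      ultimately show ?case unfolding i_def[symmetric]
        by (meson converse_rtrancl_into_rtrancl rtrancl_trans)
    qed simp
    have to_end: "(b, (q, Suc (l q))) \<in> A\<^sup>*" if "b \<in> S" for b
    proof -
      obtain i j where b: "b = (i, j)" by (cases b)
      have "i \<in> {p..q}" using that b rows[of i] by (auto simp: S)
      then show ?thesis using row[of i j] down[of "q - i"] that b by (auto intro: rtrancl_trans)
    qed
    have "sym A" by (auto simp: A_def sym_def share_side_sym)
    then have "sym (A\<^sup>*)" by (rule sym_rtrancl)
    then show ?thesis
      unfolding boxes_connected_def A_def[symmetric] 
      using to_end by (meson rtrancl_trans symD)
  qed
  moreover have "is_skew_diagram S"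
    unfolding S_def by (rule is_skew_diagram_skew[OF l e bead_move_le[OF l e r bm]])
  ultimately show "skew e l \<in> BS r"
    by (simp add: BS_def border_strip_def S_def)
  have "fst ` skew e l = {p..q}" using fst_skew[OF e] rows by auto
  then show "ht (skew e l) = q - p" using D(2) by (simp add: ht_def)
qed

text \<open>The pairs of partitions over which the sums of the Murnaghan--Nakayama rules run.\<close>

definition strip :: "nat \<Rightarrow> (nat \<Rightarrow> nat) \<Rightarrow> (nat \<Rightarrow> nat) \<Rightarrow> bool" where
  "strip r e l \<longleftrightarrow> is_partition l \<and> is_partition e \<and> diagram l \<subseteq> diagram e \<and> skew e l \<in> BS r"

lemma strip_iff_bead_move:
  assumes "r \<ge> 1"
  shows "strip r e l \<longleftrightarrow> is_partition l \<and> is_partition e \<and> (\<exists>p q. bead_move p q r l e)"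
  unfolding strip_def
  using BS_imp_bead_move[of l e r] bead_move_imp_BS(1)[of l e r] bead_move_le[of l e r] 
    diagram_subset_iff[of l e] assms by metis

definition strip_sign :: "(nat \<Rightarrow> nat) \<Rightarrow> (nat \<Rightarrow> nat) \<Rightarrow> 'a::comm_ring_1" where
  "strip_sign e l = (-1) ^ ht (skew e l)"

text \<open>The height \<open>q - p\<close> of the border strip is the number of beads that the moving bead jumps over,
  which is why the sign of the strip is the sign of sorting.\<close>

lemma bead_move_alternant:
  assumes "r \<ge> 1" "is_partition l" "is_partition e" "num_parts l \<le> N" "num_parts e \<le> N"
    "bead_move p q r l e" "q \<le> N"
  shows "alternant N g ((beads N l)(q := beads N l q + r)) = 
      strip_sign e l * alternant N g (beads N e)"
    "alternant N g ((beads N e)(p := beads N e p - r)) = 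
      strip_sign e l * alternant N g (beads N l)"
    "r \<le> beads N e p"
proof -
  note D = bead_moveD[OF assms(6)]
  have pq: "p \<in> {1..N}" "q \<in> {1..N}" using D(1,2) assms(7) by auto
  have sg: "strip_sign e l = (-1 :: 'a) ^ (p + q)"
  proof -
    have "p + q = (q - p) + 2 * p" using D(2) by simp
    then have "(-1 :: 'a) ^ (p + q) = (-1) ^ (q - p + 2 * p)" by (rule arg_cong)
    then show ?thesis
      using bead_move_imp_BS(2)[OF assms(2,3,1,6)] by (simp add: strip_sign_def power_add power_mult)
  qed
  have be: "\<forall>i\<in>{1..N}. beads N e i = move_entry q p (beads N l q + r) (beads N l) i"
    using bead_move_beads[OF assms(4,5,2,3,7) D(1,2)] assms(6) by simp
  have "alternant N g (beads N e) = alternant N g (move_entry q p (beads N l q + r) (beads N l))"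
    using be by (intro alternant_cong) auto
  also have "\<dots> = (-1) ^ (p + q) * alternant N g ((beads N l)(q := beads N l q + r))"
    by (rule alternant_move_entry[OF pq(2,1)])
  finally show "alternant N g ((beads N l)(q := beads N l q + r)) = 
      strip_sign e l * alternant N g (beads N e)"
    by (simp add: sg mult.assoc[symmetric] power_mult_distrib[symmetric])
  have bp: "beads N e p = beads N l q + r" using be pq by (simp add: move_entry_def)
  then show "r \<le> beads N e p" by simp
  have "beads N l i = move_entry p q (beads N l q) (beads N e) i" if "i \<in> {1..N}" for i
    using be[rule_format, of i] be[rule_format, of "i + 1"] D(2) pq that 
    by (auto simp: move_entry_def)
  then have "alternant N g (beads N l) = alternant N g (move_entry p q (beads N l q) (beads N e))"
    by (intro alternant_cong) auto
  also have "\<dots> = (-1) ^ (q + p) * alternant N g ((beads N e)(p := beads N l q))"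
    by (rule alternant_move_entry[OF pq])
  finally show "alternant N g ((beads N e)(p := beads N e p - r)) = 
      strip_sign e l * alternant N g (beads N l)"
    by (simp add: sg mult.assoc[symmetric] power_mult_distrib[symmetric] bp add.commute)
qed

lemma bead_move_q_le:
  assumes "is_partition l" "is_partition e" "r \<ge> 1" "bead_move p q r l e" "num_parts e \<le> N"
  shows "q \<le> N"
proof (rule ccontr)
  assume "\<not> q \<le> N"
  then have "e q = 0" using assms(2,5) num_parts_le_iff[of e N] by auto
  moreover have "l q < e q" using bead_move_less[OF assms(1-4), of q] bead_moveD(2)[OF assms(4)] by simp
  ultimately show False by simp
qed

section \<open>Adding and removing border strips in an alternant\<close>

lemma strip_num_parts:
  assumes "strip r e l" "num_parts e \<le> N" shows "num_parts l \<le> N"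
  using assms num_parts_le_iff[of l N] num_parts_le_iff[of e N] diagram_subset_iff[of l e] 
  unfolding strip_def by (metis le_zero_eq)

text \<open>The Murnaghan--Nakayama rule for an arbitrary alternant.  Raising the bead \<open>q\<close> by \<open>r\<close> either
  collides with another bead, and then two columns agree, or gives after sorting exactly one
  partition \<open>e\<close> for which \<open>e / l\<close> is a border strip with \<open>r\<close> boxes.\<close>

theorem alternant_add_strip:
  assumes r: "r \<ge> 1" and l: "is_partition l" "num_parts l \<le> N"
  shows "(\<Sum>q = 1..N. alternant N g ((beads N l)(q := beads N l q + r))) =
     (\<Sum>e | strip r e l \<and> num_parts e \<le> N. strip_sign e l * alternant N g (beads N e))"
proof -
  let ?b = "beads N l"
  \<comment> \<open>The beads that can move without collision.\<close>
  define Q where "Q = {q \<in> {1..N}. ?b q + r \<notin> ?b ` ({1..N} - {q})}"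
  define E where "E = {e. strip r e l \<and> num_parts e \<le> N}"
  have ex: "\<exists>e p. e \<in> E \<and> bead_move p q r l e" if "q \<in> Q" for q
  proof -
    have q: "q \<in> {1..N}" "?b q + r \<notin> ?b ` ({1..N} - {q})" "?b q \<le> ?b q + r" 
      using that by (auto simp: Q_def)
    obtain p where p: "p \<in> {1..q}" and dec: "decreasing N (move_entry q p (?b q + r) ?b)"
      using decreasing_move_up[OF decreasing_beads[OF l(1)] q] .
    define e where "e = of_beads N (move_entry q p (?b q + r) ?b)"
    have e: "is_partition e" "num_parts e \<le> N" 
      "\<And>i. i \<in> {1..N} \<Longrightarrow> beads N e i = move_entry q p (?b q + r) ?b i"
      using of_beads[OF dec] by (auto simp: e_def)
    have "bead_move p q r l e"
      using bead_move_beads[OF l(2) e(2) l(1) e(1), of q p r] e(3) p q by auto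
    then show ?thesis using strip_iff_bead_move[OF r] e l unfolding E_def by blast
  qed
  then obtain \<eta> \<pi> where eta: "\<And>q. q \<in> Q \<Longrightarrow> \<eta> q \<in> E \<and> bead_move (\<pi> q) q r l (\<eta> q)"
    by metis
  have inj: "inj_on \<eta> Q"
  proof (rule inj_onI)
    fix q q' assume q: "q \<in> Q" "q' \<in> Q" "\<eta> q = \<eta> q'"
    have e: "is_partition (\<eta> q)" and bm: "bead_move (\<pi> q) q r l (\<eta> q)"
      and bm': "bead_move (\<pi> q') q' r l (\<eta> q)" 
      using eta[OF q(1)] eta[OF q(2)] q(3) by (auto simp: E_def strip_def)
    have "{\<pi> q..q} = {\<pi> q'..q'}"
      using bead_move_less[OF l(1) e r bm] bead_move_less[OF l(1) e r bm'] by blast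
    then show "q = q'" 
      using bead_moveD(2)[OF bm] bead_moveD(2)[OF bm'] unfolding Icc_eq_Icc by blast
  qed
  have surj: "e \<in> \<eta> ` Q" if eE: "e \<in> E" for e
  proof -
    have e: "is_partition e" "num_parts e \<le> N" using eE by (auto simp: E_def strip_def)
    obtain p q where bm: "bead_move p q r l e" 
      using eE strip_iff_bead_move[OF r] by (auto simp: E_def)
    note D = bead_moveD[OF bm]
    have qN: "q \<le> N" by (rule bead_move_q_le[OF l(1) e(1) r bm e(2)])
    have be: "\<forall>i\<in>{1..N}. beads N e i = move_entry q p (?b q + r) ?b i"
      using bead_move_beads[OF l(2) e(2) l(1) e(1) qN D(1,2)] bm by simp
    have "?b q + r \<noteq> ?b j" if j: "j \<in> {1..N}" "j \<noteq> q" for j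
    proof -
      \<comment> \<open>The row of \<open>e\<close> that holds the bead \<open>j\<close> of \<open>l\<close>.\<close>
      define i where "i = (if p \<le> j \<and> j < q then j + 1 else j)"
      have "i \<in> {1..N}" "i \<noteq> p" using j D(1,2) qN by (auto simp: i_def)
      then have "beads N e i \<noteq> beads N e p"
        using decreasing_le_imp[OF decreasing_beads[OF e(1)], of i N p] 
          decreasing_le_imp[OF decreasing_beads[OF e(1)], of p N i] D(1,2) qN by auto
      moreover have "beads N e i = ?b j" 
        using be[rule_format, OF \<open>i \<in> {1..N}\<close>] j D(1,2) by (auto simp: i_def move_entry_def)
      moreover have "beads N e p = ?b q + r" 
        using be[rule_format, of p] D(1,2) qN by (auto simp: move_entry_def)
      ultimately show ?thesis by simp
    qed
    then have "?b q + r \<notin> ?b ` ({1..N} - {q})" by blast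
    then have q: "q \<in> Q" using D(1,2) qN by (simp add: Q_def)
    have "e = \<eta> q"
      using bead_move_unique_target[OF l(1) e(1) _ bm, of "\<eta> q" "\<pi> q"] eta[OF q] 
      by (auto simp: E_def strip_def)
    then show ?thesis using q by simp
  qed
  have "(\<Sum>q = 1..N. alternant N g (?b(q := ?b q + r))) = 
    (\<Sum>q\<in>Q. alternant N g (?b(q := ?b q + r)))"
  proof (rule sum.mono_neutral_right)
    show "\<forall>q\<in>{1..N} - Q. alternant N g (?b(q := ?b q + r)) = 0"
    proof
      fix q assume "q \<in> {1..N} - Q"
      then have "q \<in> {1..N}" "?b q + r \<in> ?b ` ({1..N} - {q})" by (auto simp only: Q_def)
      moreover from this(2) obtain j where "j \<in> {1..N} - {q}" "?b q + r = ?b j" by blast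
      ultimately show "alternant N g (?b(q := ?b q + r)) = 0"
        by (intro alternant_collision[of q N j]) auto
    qed
  qed (auto simp: Q_def)
  also have "\<dots> = (\<Sum>q\<in>Q. strip_sign (\<eta> q) l * alternant N g (beads N (\<eta> q)))"
  proof (rule sum.cong[OF refl])
    fix q assume q: "q \<in> Q"
    then have "q \<le> N" by (simp add: Q_def)
    then show "alternant N g (?b(q := ?b q + r)) = 
        strip_sign (\<eta> q) l * alternant N g (beads N (\<eta> q))"
      using bead_move_alternant(1)[OF r l(1) _ l(2), of "\<eta> q" "\<pi> q" q] eta[OF q] 
      by (auto simp: E_def strip_def)
  qed
  also have "\<dots> = (\<Sum>e\<in>\<eta> ` Q. strip_sign e l * alternant N g (beads N e))"
    by (simp add: sum.reindex[OF inj])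
  also have "\<eta> ` Q = E" using surj eta by auto
  finally show ?thesis unfolding E_def .
qed

text \<open>The same for lowering a bead.  Only beads \<open>\<ge> r\<close> can be lowered without leaving the natural
  numbers; what happens to the others depends on the alternant and produces the extra terms in the
  two applications below.\<close>

theorem alternant_remove_strip:
  assumes r: "r \<ge> 1" and e: "is_partition e" "num_parts e \<le> N"
  shows "(\<Sum>p | p \<in> {1..N} \<and> r \<le> beads N e p. alternant N g ((beads N e)(p := beads N e p - r))) =
     (\<Sum>l | strip r e l. strip_sign e l * alternant N g (beads N l))"
proof -
  let ?b = "beads N e"
  \<comment> \<open>The beads that can move without collision.\<close>
  define Q where "Q = {p \<in> {1..N}. r \<le> ?b p \<and> ?b p - r \<notin> ?b ` ({1..N} - {p})}"
  define L where "L = {l. strip r e l}"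
  have LN: "num_parts l \<le> N" "is_partition l" if "l \<in> L" for l
    using that strip_num_parts[of r e l N] e by (auto simp: L_def strip_def)
  have ex: "\<exists>l q. l \<in> L \<and> bead_move p q r l e" if "p \<in> Q" for p
  proof -
    have p: "p \<in> {1..N}" "?b p - r \<notin> ?b ` ({1..N} - {p})" "?b p - r \<le> ?b p" "r \<le> ?b p"
      using that by (auto simp: Q_def)
    obtain q where q: "q \<in> {p..N}" and dec: "decreasing N (move_entry p q (?b p - r) ?b)"
      using decreasing_move_down[OF decreasing_beads[OF e(1)] p(1-3)] .
    define l where "l = of_beads N (move_entry p q (?b p - r) ?b)"
    have l: "is_partition l" "num_parts l \<le> N" 
      "\<And>i. i \<in> {1..N} \<Longrightarrow> beads N l i = move_entry p q (?b p - r) ?b i"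
      using of_beads[OF dec] by (auto simp: l_def)
    have "beads N e i = move_entry q p (beads N l q + r) (beads N l) i" if "i \<in> {1..N}" for i
    proof -
      obtain i' where "i = Suc i'" using \<open>i \<in> {1..N}\<close> by (cases i) auto
      then show ?thesis
        using l(3)[of i] l(3)[of i'] l(3)[of q] p q that by (auto simp: move_entry_def)
    qed
    then have "bead_move p q r l e"
      using bead_move_beads[OF l(2) e(2) l(1) e(1), of q p r] p q by auto
    then show ?thesis using strip_iff_bead_move[OF r] e l unfolding L_def by blast
  qed
  then obtain \<xi> \<kappa> where xi: "\<And>p. p \<in> Q \<Longrightarrow> \<xi> p \<in> L \<and> bead_move p (\<kappa> p) r (\<xi> p) e"
    by metis
  have inj: "inj_on \<xi> Q"
  proof (rule inj_onI)
    fix p p' assume p: "p \<in> Q" "p' \<in> Q" "\<xi> p = \<xi> p'"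
    have l: "is_partition (\<xi> p)" and bm: "bead_move p (\<kappa> p) r (\<xi> p) e"
      and bm': "bead_move p' (\<kappa> p') r (\<xi> p) e" 
      using xi[OF p(1)] xi[OF p(2)] p(3) by (auto simp: L_def strip_def)
    have "{p..\<kappa> p} = {p'..\<kappa> p'}"
      using bead_move_less[OF l e(1) r bm] bead_move_less[OF l e(1) r bm'] by blast
    then show "p = p'" 
      using bead_moveD(2)[OF bm] bead_moveD(2)[OF bm'] unfolding Icc_eq_Icc by blast
  qed
  have surj: "l \<in> \<xi> ` Q" if lL: "l \<in> L" for l
  proof -
    note l = LN[OF lL]
    obtain p q where bm: "bead_move p q r l e" 
      using lL strip_iff_bead_move[OF r] by (auto simp: L_def)
    note D = bead_moveD[OF bm]
    have qN: "q \<le> N" by (rule bead_move_q_le[OF l(2) e(1) r bm e(2)])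
    have be: "\<forall>i\<in>{1..N}. beads N e i = move_entry q p (beads N l q + r) (beads N l) i"
      using bead_move_beads[OF l(1) e(2) l(2) e(1) qN D(1,2)] bm by simp
    have bp: "?b p = beads N l q + r" 
      using be[rule_format, of p] D(1,2) qN by (auto simp: move_entry_def)
    have "beads N l q \<noteq> ?b j" if j: "j \<in> {1..N}" "j \<noteq> p" for j
    proof -
      \<comment> \<open>The row of \<open>l\<close> that holds the bead \<open>j\<close> of \<open>e\<close>.\<close>
      define i where "i = (if p < j \<and> j \<le> q then j - 1 else j)"
      have "i \<in> {1..N}" "i \<noteq> q" using j D(1,2) qN by (auto simp: i_def)
      then have "beads N l i \<noteq> beads N l q"
        using decreasing_le_imp[OF decreasing_beads[OF l(2)], of i N q] 
          decreasing_le_imp[OF decreasing_beads[OF l(2)], of q N i] D(1,2) qN by auto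
      moreover have "?b j = beads N l i" 
        using be[rule_format, OF j(1)] j D(1,2) by (auto simp: i_def move_entry_def)
      ultimately show ?thesis by simp
    qed
    moreover have "?b p - r = beads N l q" using bp by simp
    ultimately have "?b p - r \<notin> ?b ` ({1..N} - {p})" by (simp only:) blast
    then have p: "p \<in> Q" using D(1,2) qN bp by (simp add: Q_def)
    have "l = \<xi> p"
      using bead_move_unique_source[OF l(2) _ e(1) bm, of "\<xi> p" "\<kappa> p"] xi[OF p] 
      by (auto simp: L_def strip_def)
    then show ?thesis using p by simp
  qed
  have "(\<Sum>p | p \<in> {1..N} \<and> r \<le> ?b p. alternant N g (?b(p := ?b p - r))) = 
    (\<Sum>p\<in>Q. alternant N g (?b(p := ?b p - r)))"
  proof (rule sum.mono_neutral_right)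
    show "\<forall>p\<in>{p. p \<in> {1..N} \<and> r \<le> ?b p} - Q. alternant N g (?b(p := ?b p - r)) = 0"
    proof
      fix p assume "p \<in> {p. p \<in> {1..N} \<and> r \<le> ?b p} - Q"
      then have "p \<in> {1..N}" "?b p - r \<in> ?b ` ({1..N} - {p})" by (auto simp only: Q_def)
      moreover from this(2) obtain j where "j \<in> {1..N} - {p}" "?b p - r = ?b j" by blast
      ultimately show "alternant N g (?b(p := ?b p - r)) = 0"
        by (intro alternant_collision[of p N j]) auto
    qed
  qed (auto simp: Q_def)
  also have "\<dots> = (\<Sum>p\<in>Q. strip_sign e (\<xi> p) * alternant N g (beads N (\<xi> p)))"
  proof (rule sum.cong[OF refl])
    fix p assume p: "p \<in> Q"
    have bm: "bead_move p (\<kappa> p) r (\<xi> p) e" and "\<xi> p \<in> L" using xi[OF p] by auto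
    note l = LN[OF this(2)]
    have "\<kappa> p \<le> N" by (rule bead_move_q_le[OF l(2) e(1) r bm e(2)])
    then show "alternant N g (?b(p := ?b p - r)) = 
        strip_sign e (\<xi> p) * alternant N g (beads N (\<xi> p))"
      by (rule bead_move_alternant(2)[OF r l(2) e(1) l(1) e(2) bm])
  qed
  also have "\<dots> = (\<Sum>l\<in>\<xi> ` Q. strip_sign e l * alternant N g (beads N l))"
    by (simp add: sum.reindex[OF inj])
  also have "\<xi> ` Q = L" using surj xi by auto
  finally show ?thesis unfolding L_def .
qed

section \<open>Power sums times symplectic Schur polynomials\<close>

text \<open>The shift by one makes the exponents of the symplectic numerator equal to the bead positions
  plus one, hence positive.\<close>

definition sp_entry :: "(nat \<Rightarrow> 'a::field) \<Rightarrow> nat \<Rightarrow> nat \<Rightarrow> 'a" where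
  "sp_entry x i b = x i ^ (b + 1) - inverse (x i) ^ (b + 1)"

lemma sp_eq_alternant:
  "sp n x l = (if num_parts l \<le> n then alternant n (sp_entry x) (beads n l) / 
     alternant n (sp_entry x) (\<lambda>j. n - j) else 0)"
proof -
  have "det1 n (\<lambda>i j. x i ^ (l j + n - j + 1) - inverse (x i) ^ (l j + n - j + 1)) =
      alternant n (sp_entry x) (beads n l)"
    unfolding alternant_def sp_entry_def beads_def by (rule det1_cong) simp
  moreover have "det1 n (\<lambda>i j. x i ^ (n - j + 1) - inverse (x i) ^ (n - j + 1)) =
      alternant n (sp_entry x) (\<lambda>j. n - j)"
    unfolding alternant_def sp_entry_def ..
  ultimately show ?thesis by (simp add: sp_def)
qed

text \<open>With \<open>z\<^sub>a = x\<^sup>a - x\<^sup>-\<^sup>a\<close> one has \<open>(x\<^sup>r + x\<^sup>-\<^sup>r) z\<^sub>a = z\<^bsub>a + r\<^esub> + z\<^bsub>a - r\<^esub>\<close>.  As \<open>z\<close> is odd, a negative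
  exponent \<open>a - r\<close> is reflected to \<open>r - a\<close> at the cost of a sign, and \<open>z\<^sub>0 = 0\<close>.  Here
  \<open>a = b + 1\<close>.\<close>

lemma sp_entry_reflect:
  assumes "x i \<noteq> 0"
  shows "(x i ^ r + inverse (x i) ^ r) * sp_entry x i b = sp_entry x i (b + r) +
    (if r \<le> b then sp_entry x i (b - r) 
     else if b + 1 < r then - sp_entry x i (r - b - 2) else 0)"
proof -
  define u where "u = x i"
  define w where "w = inverse u"
  have uw: "u * w = 1" using assms by (simp add: u_def w_def)
  have pw: "u ^ k * w ^ k = 1" for k by (simp add: power_mult_distrib[symmetric] uw)
  have cancel: "u ^ (k + l) * w ^ k = u ^ l" "w ^ (k + l) * u ^ k = w ^ l" for k l
    using pw[of k] by (simp_all add: power_add algebra_simps)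
  have expand: "(u ^ r + w ^ r) * (u ^ c - w ^ c) = 
    (u ^ (c + r) - w ^ (c + r)) + (u ^ c * w ^ r - w ^ c * u ^ r)" for c
    by (simp add: power_add algebra_simps)
  consider "r \<le> b" | "r = b + 1" | "b + 1 < r" by linarith
  then show ?thesis
  proof cases
    case 1
    then have "b + 1 = r + (b - r + 1)" by simp
    then have "u ^ (b + 1) * w ^ r - w ^ (b + 1) * u ^ r = u ^ (b - r + 1) - w ^ (b - r + 1)"
      by (metis cancel)
    then show ?thesis using 1 expand[of "b + 1"] 
      by (simp only: sp_entry_def u_def[symmetric] w_def[symmetric]) (simp add: algebra_simps)
  next
    case 2
    then show ?thesis using expand[of r]
      by (simp only: sp_entry_def u_def[symmetric] w_def[symmetric]) (simp add: algebra_simps)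
  next
    case 3
    then have "r = (b + 1) + (r - b - 2 + 1)" by simp
    then have "u ^ (b + 1) * w ^ r - w ^ (b + 1) * u ^ r = 
        - (u ^ (r - b - 2 + 1) - w ^ (r - b - 2 + 1))"
      by (metis cancel minus_diff_eq mult.commute)
    then show ?thesis using 3 expand[of "b + 1"] 
      by (simp only: sp_entry_def u_def[symmetric] w_def[symmetric]) (simp add: algebra_simps)
  qed
qed

text \<open>Multiplying by the power sum scales one row at a time; exchanging rows for columns, one exponent
  at a time is changed by \<open>\<plusminus>r\<close>.\<close>

lemma power_sum_times_alternant:
  assumes nz: "\<And>i. i \<in> {1..n} \<Longrightarrow> x i \<noteq> 0"
  shows "(\<Sum>i = 1..n. x i ^ r + inverse (x i) ^ r) * alternant n (sp_entry x) b =
    (\<Sum>q = 1..n. alternant n (sp_entry x) (b(q := b q + r))) +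
    (\<Sum>q | q \<in> {1..n} \<and> r \<le> b q. alternant n (sp_entry x) (b(q := b q - r))) -
    (\<Sum>q | q \<in> {1..n} \<and> b q + 1 < r. alternant n (sp_entry x) (b(q := r - b q - 2)))"
proof -
  let ?g = "sp_entry x" and ?a = "\<lambda>i j. sp_entry x i (b j)"
  let ?c = "\<lambda>i. x i ^ r + inverse (x i) ^ r"
  have row: "det1 n (\<lambda>i j. if i = k then ?c i * ?a i j else ?a i j) = ?c k * det1 n ?a"
    if k: "k \<in> {1..n}" for k
  proof -
    have "det1 n (\<lambda>i j. if i = k then ?c i * ?a i j else ?a i j) =
      det1 n (replace_column k (\<lambda>j. ?c k * ?a k j) (\<lambda>j i. ?a i j))"
      unfolding replace_column_def by (subst det1_transpose[symmetric]) (rule det1_cong, simp)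
    also have "\<dots> = ?c k * det1 n (replace_column k (\<lambda>j. ?a k j) (\<lambda>j i. ?a i j))"
      by (rule det1_replace_column_scale[OF k])
    also have "det1 n (replace_column k (\<lambda>j. ?a k j) (\<lambda>j i. ?a i j)) = det1 n (\<lambda>j i. ?a i j)"
      unfolding replace_column_def by (rule det1_cong) simp
    also have "\<dots> = det1 n ?a" by (rule det1_transpose)
    finally show ?thesis .
  qed
  have col: "det1 n (replace_column q (\<lambda>i. ?c i * ?a i q) ?a) =
      alternant n ?g (b(q := b q + r)) + 
      (if r \<le> b q then alternant n ?g (b(q := b q - r)) else 0) -
      (if b q + 1 < r then alternant n ?g (b(q := r - b q - 2)) else 0)" if q: "q \<in> {1..n}" for q
  proof -
    have "det1 n (replace_column q (\<lambda>i. ?c i * ?a i q) ?a) = 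
      det1 n (replace_column q (\<lambda>i. ?g i (b q + r) + 
        (if r \<le> b q then ?g i (b q - r) else if b q + 1 < r then (-1) * ?g i (r - b q - 2) else 0)) ?a)"
      unfolding replace_column_def by (rule det1_cong) (simp add: sp_entry_reflect nz)
    also have "\<dots> = alternant n ?g (b(q := b q + r)) + 
       det1 n (replace_column q (\<lambda>i. if r \<le> b q then ?g i (b q - r) 
         else if b q + 1 < r then (-1) * ?g i (r - b q - 2) else 0) ?a)"
      unfolding det1_replace_column_add[OF q] alternant_upd ..
    also have "det1 n (replace_column q (\<lambda>i. if r \<le> b q then ?g i (b q - r) 
         else if b q + 1 < r then (-1) * ?g i (r - b q - 2) else 0) ?a) =
      (if r \<le> b q then alternant n ?g (b(q := b q - r)) else 0) -
      (if b q + 1 < r then alternant n ?g (b(q := r - b q - 2)) else 0)"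
    proof -
      consider "r \<le> b q" | "b q + 1 < r" | "\<not> r \<le> b q" "\<not> b q + 1 < r" by blast
      then show ?thesis
      proof cases
        case 1
        then show ?thesis by (simp add: alternant_upd)
      next
        case 2
        then have "\<not> r \<le> b q" by simp
        then show ?thesis using 2
          by (simp only: if_True if_False det1_replace_column_scale[OF q] alternant_upd) simp
      next
        case 3
        then show ?thesis using det1_replace_column_scale[OF q, of 0 "\<lambda>_. 0" ?a] by simp
      qed
    qed
    finally show ?thesis by (simp only: add_diff_eq)
  qed
  have "(\<Sum>i = 1..n. ?c i) * alternant n ?g b = (\<Sum>k = 1..n. ?c k * det1 n ?a)"
    by (simp add: sum_distrib_right alternant_def)
  also have "\<dots> = (\<Sum>k = 1..n. det1 n (\<lambda>i j. if i = k then ?c i * ?a i j else ?a i j))"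
    by (intro sum.cong refl) (simp only: row)
  also have "\<dots> = (\<Sum>q = 1..n. det1 n (replace_column q (\<lambda>i. ?c i * ?a i q) ?a))"
    by (rule det1_sum_replace_row_eq_column)
  also have "\<dots> = (\<Sum>q = 1..n. alternant n ?g (b(q := b q + r)) + 
      (if r \<le> b q then alternant n ?g (b(q := b q - r)) else 0) -
      (if b q + 1 < r then alternant n ?g (b(q := r - b q - 2)) else 0))"
    by (intro sum.cong refl) (simp only: col)
  also have "\<dots> = (\<Sum>q = 1..n. alternant n ?g (b(q := b q + r))) +
    (\<Sum>q = 1..n. if r \<le> b q then alternant n ?g (b(q := b q - r)) else 0) -
    (\<Sum>q = 1..n. if b q + 1 < r then alternant n ?g (b(q := r - b q - 2)) else 0)"
    by (simp add: sum.distrib sum_subtractf)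
  also have "(\<Sum>q = 1..n. if r \<le> b q then alternant n ?g (b(q := b q - r)) else 0) = 
     (\<Sum>q | q \<in> {1..n} \<and> r \<le> b q. alternant n ?g (b(q := b q - r)))"
    by (rule sum.inter_filter[symmetric]) simp
  also have "(\<Sum>q = 1..n. if b q + 1 < r then alternant n ?g (b(q := r - b q - 2)) else 0) = 
     (\<Sum>q | q \<in> {1..n} \<and> b q + 1 < r. alternant n ?g (b(q := r - b q - 2)))"
    by (rule sum.inter_filter[symmetric]) simp
  finally show ?thesis .
qed

text \<open>A sequence that is strictly decreasing and takes only values of the injective \<open>f\<close> must be the
  sorted version of \<open>f\<close>, by counting.\<close>

lemma sort_eq_rev_map:
  assumes d: "decreasing n d" and inj: "inj_on f {1..n}" and sub: "d ` {1..n} \<subseteq> f ` {1..n}"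
  shows "rev (sort (map f [1..<n + 1])) = map d [1..<n + 1]"
proof -
  have set: "set [1..<n + 1] = {1..n}" by auto
  have injd: "inj_on d {1..n}"
    by (rule inj_onI) (metis decreasing_le_imp[OF d] le_antisym order_refl)
  have "d ` {1..n} = f ` {1..n}"
    using sub by (intro card_subset_eq) (simp_all only: card_image[OF inj] card_image[OF injd] finite_imageI finite_atLeastAtMost)
  then have "mset (map d [1..<n + 1]) = mset (map f [1..<n + 1])"
    using inj injd by (intro set_eq_iff_mset_eq_distinct[THEN iffD1]) (simp_all only: distinct_map distinct_upt set set_map simp_thms)
  then have "mset (rev (map d [1..<n + 1])) = mset (map f [1..<n + 1])" by simp
  moreover have "sorted (rev (map d [1..<n + 1]))"
    unfolding sorted_rev_iff_nth_mono
  proof (intro allI impI)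
    fix i j assume "i \<le> j" "j < length (map d [1..<n + 1])"
    then show "map d [1..<n + 1] ! j \<le> map d [1..<n + 1] ! i"
      using decreasingD[OF d, of "Suc i" "Suc j"] by (cases "i = j") (auto simp del: upt_Suc)
  qed
  ultimately have "sort (map f [1..<n + 1]) = rev (map d [1..<n + 1])"
    by (rule properties_for_sort)
  then show ?thesis by simp
qed

lemma neg_one_powi: "(-1 :: 'a::field) powi (int p - int q + 1) = - ((-1) ^ (p + q))"
proof -
  have "even (int p - int q + 1) \<longleftrightarrow> odd (p + q)" by simp
  then show ?thesis by (simp add: power_int_minus_left minus_one_power_iff)
qed

text \<open>The reflected exponent is sorted back into the decreasing sequence at position \<open>p_index\<close>, which
  costs the sign \<open>(-1)\<^bsup>p - q\<^esup>\<close>; the reflection itself contributes one more sign.\<close>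

lemma reflected_alternant:
  assumes l: "is_partition l" "num_parts l \<le> n" and q: "q \<in> {1..n}" "beads n l q + 1 < r"
  shows "- (alternant n (sp_entry x) ((beads n l)(q := r - beads n l q - 2)) / 
     alternant n (sp_entry x) (\<lambda>j. n - j)) =
     (-1) powi (int (p_index n r l q) - int q + 1) * sp_mu_q n r x l q"
proof -
  let ?b = "beads n l"
  \<comment> \<open>The exponent is \<open>?b q + 1\<close>; its reflection is \<open>r - (?b q + 1) = w + 1\<close>, the entry of \<open>sp_entry\<close> at \<open>w\<close>.\<close>
  define w where "w = r - ?b q - 2"
  have ent: "l j + delta n j = ?b j + 1" if "j \<in> {1..n}" for j
    using that by (simp add: beads_def delta_def Suc_diff_le)
  have new: "new_entry n r l q = w + 1"
    using q by (simp add: new_entry_def ent w_def)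
  have coll: "collision n r l q \<longleftrightarrow> w \<in> ?b ` ({1..n} - {q})"
    unfolding collision_def new using ent by (auto simp: image_iff)
  show ?thesis
  proof (cases "collision n r l q")
    case True
    then have "w \<in> ?b ` ({1..n} - {q})" using coll by blast
    then obtain j where "j \<in> {1..n} - {q}" "w = ?b j" by blast
    then have "alternant n (sp_entry x) (?b(q := w)) = 0"
      using q by (intro alternant_collision[of q n j]) auto
    then show ?thesis using True by (simp add: sp_mu_q_def w_def)
  next
    case False
    then have w: "w \<notin> ?b ` ({1..n} - {q})" by (simp add: coll)
    obtain p where p: "p \<in> {1..n}" and dec: "decreasing n (move_entry q p w ?b)"
    proof (cases "?b q \<le> w")
      case True
      from decreasing_move_up[OF decreasing_beads[OF l(1)] q(1) w True] obtain p 
        where "p \<in> {1..q}" "decreasing n (move_entry q p w ?b)" .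
      then show ?thesis using q that[of p] by auto
    next
      case False
      then have "w \<le> ?b q" by simp
      from decreasing_move_down[OF decreasing_beads[OF l(1)] q(1) w this] obtain p 
        where "p \<in> {q..n}" "decreasing n (move_entry q p w ?b)" .
      then show ?thesis using q that[of p] by auto
    qed
    define d where "d i = move_entry q p w ?b i + 1" for i
    have dec': "decreasing n d" using dec by (simp add: decreasing_def d_def)
    have Delta: "Delta n r l q i = d i" if "i \<in> {1..n}" for i
    proof -
      let ?f = "\<lambda>k. if k = q then new_entry n r l q else l k + delta n k"
      have f: "?f k = (?b(q := w)) k + 1" if "k \<in> {1..n}" for k
        using ent[OF that] new by simp
      have bne: "?b j \<noteq> ?b k" if "j \<in> {1..n}" "k \<in> {1..n}" "j \<noteq> k" for j k
        using decreasing_le_imp[OF decreasing_beads[OF l(1)], of j n k] 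
          decreasing_le_imp[OF decreasing_beads[OF l(1)], of k n j] that by auto
      have "inj_on ?f {1..n}"
      proof (rule inj_onI, rule ccontr)
        fix j k assume jk: "j \<in> {1..n}" "k \<in> {1..n}" "?f j = ?f k" "j \<noteq> k"
        have "(?b(q := w)) j = (?b(q := w)) k" using jk(3) unfolding f[OF jk(1)] f[OF jk(2)] by simp
        then show False using w bne[OF jk(1,2,4)] jk 
          by (cases "j = q"; cases "k = q") (auto simp: image_iff)
      qed
      moreover have "d ` {1..n} \<subseteq> ?f ` {1..n}"
      proof
        fix t assume "t \<in> d ` {1..n}"
        then obtain i where i: "i \<in> {1..n}" "t = d i" by auto
        \<comment> \<open>The position that the sorted entry \<open>i\<close> had before sorting.\<close>
        define j where "j = (if i = p then q else if p < i \<and> i \<le> q then i - 1 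
          else if q \<le> i \<and> i < p then i + 1 else i)"
        have "j \<in> {1..n}" using i p q by (auto simp: j_def)
        moreover have "t = ?f j" 
          unfolding f[OF \<open>j \<in> {1..n}\<close>] i(2) d_def using p q i(1) by (auto simp: j_def move_entry_def)
        ultimately show "t \<in> ?f ` {1..n}" by (rule image_eqI[rotated])
      qed
      ultimately have "rev (sort (map ?f [1..<n + 1])) = map d [1..<n + 1]"
        by (rule sort_eq_rev_map[OF dec'])
      moreover obtain i' where "i = Suc i'" using \<open>i \<in> {1..n}\<close> by (cases i) auto
      ultimately show ?thesis using that unfolding Delta_def by (simp del: upt_Suc)
    qed
    have pind: "p_index n r l q = p"
      unfolding p_index_def
    proof (rule the_equality)
      show "p \<in> {1..n} \<and> Delta n r l q p = new_entry n r l q"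
        using p Delta[OF p] new by (simp add: d_def move_entry_def)
      fix p' assume p': "p' \<in> {1..n} \<and> Delta n r l q p' = new_entry n r l q"
      then have "d p' = d p" using Delta[of p'] new by (simp add: d_def move_entry_def)
      then show "p' = p"
        using decreasing_le_imp[OF dec', of p p'] decreasing_le_imp[OF dec', of p' p] p p' by auto
    qed
    have muq: "mu_q n r l q = of_beads n (move_entry q p w ?b)"
    proof
      fix i show "mu_q n r l q i = of_beads n (move_entry q p w ?b) i"
        using Delta[of i] by (auto simp: mu_q_def of_beads_def d_def delta_def Suc_diff_le)
    qed
    have "alternant n (sp_entry x) (beads n (of_beads n (move_entry q p w ?b))) = 
        alternant n (sp_entry x) (move_entry q p w ?b)"
      by (rule alternant_cong) (rule of_beads(3)[OF dec])
    then have "sp_mu_q n r x l q = alternant n (sp_entry x) (move_entry q p w ?b) /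
       alternant n (sp_entry x) (\<lambda>j. n - j)"
      using False of_beads(2)[OF dec] by (simp add: sp_mu_q_def muq sp_eq_alternant)
    also have "alternant n (sp_entry x) (move_entry q p w ?b) = 
       (-1) ^ (p + q) * alternant n (sp_entry x) (?b(q := w))"
      by (rule alternant_move_entry[OF q(1) p])
    finally show ?thesis
      by (simp add: pind neg_one_powi w_def mult.assoc[symmetric] power_mult_distrib[symmetric])
  qed
qed

lemma m_index_interval:
  "{m_index n r l + 1..n} = {q \<in> {1..n}. l q + delta n q < r}" if l: "is_partition l"
proof -
  have mono: "l j + delta n j \<le> l i + delta n i" if "1 \<le> i" "i \<le> j" for i j
    using partition_antimono[OF l that] that by (auto simp: delta_def)
  show ?thesis
  proof (cases "\<forall>i\<in>{1..n}. l i + delta n i < r")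
    case True
    then show ?thesis by (auto simp: m_index_def)
  next
    case False
    define M where "M = {i \<in> {1..n}. l i + delta n i \<ge> r}"
    have M: "finite M" "M \<noteq> {}" using False by (auto simp: M_def not_less)
    have m: "m_index n r l = Max M" unfolding m_index_def M_def using False by (simp only: if_False)
    have "Max M \<in> M" using M by (rule Max_in)
    show ?thesis
    proof (rule Set.set_eqI)
      fix q
      have "q \<le> Max M" if "q \<in> {1..n}" "\<not> l q + delta n q < r" 
        using that M by (intro Max_ge) (auto simp: M_def)
      moreover have "\<not> l q + delta n q < r" if "1 \<le> q" "q \<le> Max M"
        using mono[OF that] \<open>Max M \<in> M\<close> by (auto simp: M_def)
      ultimately show "q \<in> {m_index n r l + 1..n} \<longleftrightarrow> q \<in> {q \<in> {1..n}. l q + delta n q < r}"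
        unfolding m by (force simp: not_less)
    qed
  qed
qed

text \<open>If the Weyl denominator vanishes, all symplectic Schur polynomials are zero by the convention on
  division.  If it does not, no \<open>x i\<close> can be zero, as its row would vanish.  In both cases
  the identity follows, for arbitrary elements \<open>x i\<close> of a field.\<close>

theorem power_sum_times_sp:
  assumes r: "r \<ge> 1" and l: "is_partition l" "num_parts l \<le> n"
  shows "(\<Sum>i = 1..n. x i ^ r + inverse (x i) ^ r) * sp n x l =
    (\<Sum>e | strip r e l \<and> num_parts e \<le> n. strip_sign e l * sp n x e) +
    (\<Sum>k | strip r l k. strip_sign l k * sp n x k) +
    (\<Sum>q = m_index n r l + 1..n. 
       (-1) powi (int (p_index n r l q) - int q + 1) * sp_mu_q n r x l q)"
proof -
  let ?A = "alternant n (sp_entry x)"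
  let ?D = "?A (\<lambda>j. n - j)"
  show ?thesis
  proof (cases "?D = 0")
    case True
    then have "sp n x k = 0" for k by (simp add: sp_eq_alternant)
    then have "sp n x k = 0" "sp_mu_q n r x l q = 0" for k q by (simp_all add: sp_mu_q_def)
    then show ?thesis by simp
  next
    case D: False
    have nz: "x i \<noteq> 0" if "i \<in> {1..n}" for i
    proof
      assume "x i = 0"
      then have "?D = 0"
        unfolding alternant_def using that
        by (intro det1_zero_block[of "{i}" n "{}"]) (auto simp: sp_entry_def)
      then show False using D by simp
    qed
    have refl: "{q. q \<in> {1..n} \<and> beads n l q + 1 < r} = {m_index n r l + 1..n}"
      unfolding m_index_interval[OF l(1)] by (auto simp: beads_def delta_def Suc_diff_le)
    have "(\<Sum>i = 1..n. x i ^ r + inverse (x i) ^ r) * ?A (beads n l) = 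
      (\<Sum>e | strip r e l \<and> num_parts e \<le> n. strip_sign e l * ?A (beads n e)) +
      (\<Sum>k | strip r l k. strip_sign l k * ?A (beads n k)) -
      (\<Sum>q = m_index n r l + 1..n. ?A ((beads n l)(q := r - beads n l q - 2)))"
      using power_sum_times_alternant[of n x r "beads n l", OF nz]
      unfolding alternant_add_strip[OF r l] alternant_remove_strip[OF r l] refl .
    then have "(\<Sum>i = 1..n. x i ^ r + inverse (x i) ^ r) * sp n x l = 
      (\<Sum>e | strip r e l \<and> num_parts e \<le> n. strip_sign e l * ?A (beads n e)) / ?D +
      (\<Sum>k | strip r l k. strip_sign l k * ?A (beads n k)) / ?D + 
      (\<Sum>q = m_index n r l + 1..n. - (?A ((beads n l)(q := r - beads n l q - 2)) / ?D))"
      using l unfolding sum_negf sum_divide_distrib[symmetric]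
      by (simp only: sp_eq_alternant if_True times_divide_eq_right add_divide_distrib 
        diff_divide_distrib) simp
    also have "(\<Sum>e | strip r e l \<and> num_parts e \<le> n. strip_sign e l * ?A (beads n e)) / ?D =
       (\<Sum>e | strip r e l \<and> num_parts e \<le> n. strip_sign e l * sp n x e)"
      by (simp add: sum_divide_distrib sp_eq_alternant)
    also have "(\<Sum>k | strip r l k. strip_sign l k * ?A (beads n k)) / ?D = 
       (\<Sum>k | strip r l k. strip_sign l k * sp n x k)"
      unfolding sum_divide_distrib
    proof (rule sum.cong)
      fix k assume "k \<in> {k. strip r l k}"
      then have "num_parts k \<le> n" using strip_num_parts[OF _ l(2), of r k] by simp
      then show "strip_sign l k * ?A (beads n k) / ?D = strip_sign l k * sp n x k"
        by (simp add: sp_eq_alternant)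
    qed simp
    also have "(\<Sum>q = m_index n r l + 1..n. - (?A ((beads n l)(q := r - beads n l q - 2)) / ?D)) =
       (\<Sum>q = m_index n r l + 1..n. 
         (-1) powi (int (p_index n r l q) - int q + 1) * sp_mu_q n r x l q)"
      by (intro sum.cong refl reflected_alternant l) (use refl in blast)+
    finally show ?thesis .
  qed
qed

section \<open>Vertical strips and border strips\<close>

definition vertical_strip :: "(nat \<Rightarrow> nat) \<Rightarrow> (nat \<Rightarrow> nat) \<Rightarrow> bool" where
  "vertical_strip a b \<longleftrightarrow> (\<forall>i. a i = b i \<or> a i = Suc (b i))"

text \<open>The skew Schur polynomial in the single variable \<open>y\<close> of the conjugate shape.\<close>

definition vertical_weight :: "'a::field \<Rightarrow> (nat \<Rightarrow> nat) \<Rightarrow> (nat \<Rightarrow> nat) \<Rightarrow> 'a" where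
  "vertical_weight y a b = (if vertical_strip a b then y ^ card (skew a b) else 0)"

text \<open>The elementary symmetric polynomial of degree \<open>s - t\<close> in the single variable \<open>y\<close>.\<close>

definition elem_entry :: "'a::field \<Rightarrow> nat \<Rightarrow> nat \<Rightarrow> 'a" where
  "elem_entry y s t = (if s = t then 1 else if s = t + 1 then y else 0)"

lemma prod_elem_entry:
  assumes a: "is_partition a" "num_parts a \<le> N" and b: "is_partition b" "num_parts b \<le> N"
  shows "(\<Prod>i = 1..N. elem_entry y (a i) (b i)) = vertical_weight y a b"
proof (cases "vertical_strip a b")
  case True
  then have e: "elem_entry y (a i) (b i) = (if b i < a i then y else 1)" for i
    unfolding vertical_strip_def elem_entry_def by (metis less_irrefl Suc_eq_plus1 lessI)
  have sub: "{i. b i < a i} \<subseteq> {1..N}"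
  proof
    fix i assume i: "i \<in> {i. b i < a i}"
    then have "i \<noteq> 0" using partition_0[OF a(1)] by (cases i) auto
    moreover have "i \<le> N" 
    proof (rule ccontr)
      assume "\<not> i \<le> N"
      then have "a i = 0" using a num_parts_le_iff[of a N] by auto
      then show False using i by simp
    qed
    ultimately show "i \<in> {1..N}" by simp
  qed
  have "card (skew a b) = (\<Sum>i | b i < a i. a i - b i)" by (rule card_skew[OF a(1)])
  also have "\<dots> = (\<Sum>i | b i < a i. 1)"
  proof (rule sum.cong[OF refl])
    fix i assume "i \<in> {i. b i < a i}"
    then show "a i - b i = 1" using True[unfolded vertical_strip_def, rule_format, of i] by auto
  qed
  finally have c: "card (skew a b) = card {i. b i < a i}" by simp
  have "(\<Prod>i = 1..N. elem_entry y (a i) (b i)) = (\<Prod>i\<in>{1..N} \<inter> {i. b i < a i}. y)"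
    unfolding e by (subst prod.inter_restrict) simp_all
  also have "{1..N} \<inter> {i. b i < a i} = {i. b i < a i}" using sub by blast
  finally show ?thesis using True c by (simp add: vertical_weight_def)
next
  case False
  then obtain i where i: "a i \<noteq> b i" "a i \<noteq> Suc (b i)" by (auto simp: vertical_strip_def)
  have "i \<noteq> 0" using i partition_0[OF a(1)] partition_0[OF b(1)] by (cases i) auto
  moreover have "i \<le> N" 
  proof (rule ccontr)
    assume "\<not> i \<le> N"
    then have "a i = 0" "b i = 0" 
      using a b num_parts_le_iff[of a N] num_parts_le_iff[of b N] by auto
    then show False using i by simp
  qed
  moreover have "elem_entry y (a i) (b i) = 0" using i by (simp add: elem_entry_def)
  ultimately have "(\<Prod>i = 1..N. elem_entry y (a i) (b i)) = 0"
    by (intro prod_zero finite_atLeastAtMost bexI[of _ i]) simp_all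
  then show ?thesis using False by (simp add: vertical_weight_def)
qed

text \<open>The dual Jacobi--Trudi formula for one variable.  Since \<open>a\<^sub>i - b\<^sub>j \<in> {0, 1}\<close> at each nonzero entry
  and both bead sequences are strictly decreasing, no inversion consists of nonzero entries and only
  the diagonal product survives.\<close>

lemma det1_elem_entry:
  assumes a: "is_partition a" "num_parts a \<le> N" and b: "is_partition b" "num_parts b \<le> N"
  shows "det1 N (\<lambda>i j. elem_entry y (beads N a i) (beads N b j)) = vertical_weight y a b"
proof -
  have "det1 N (\<lambda>i j. elem_entry y (beads N a i) (beads N b j)) = 
     (\<Prod>i = 1..N. elem_entry y (beads N a i) (beads N b i))"
  proof (rule det1_monotone_support)
    fix i k j l assume "i \<in> {1..N}" "k \<in> {1..N}" "j \<in> {1..N}" "l \<in> {1..N}" "i < k" "l < j"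
    then have "beads N a k < beads N a i" "beads N b j < beads N b l"
      using decreasingD[OF decreasing_beads[OF a(1)], of i k N] 
        decreasingD[OF decreasing_beads[OF b(1)], of l j N] by auto
    then show "elem_entry y (beads N a i) (beads N b j) = 0 \<or> 
        elem_entry y (beads N a k) (beads N b l) = 0"
      by (auto simp: elem_entry_def)
  qed
  also have "\<dots> = (\<Prod>i = 1..N. elem_entry y (a i) (b i))"
  proof -
    have "elem_entry y (s + c) (t + c) = elem_entry y s t" for s t c
      by (simp add: elem_entry_def)
    then show ?thesis unfolding beads_def by (simp only:)
  qed
  finally show ?thesis using prod_elem_entry[OF assms] by simp
qed

lemma alternant_elem_entry:
  assumes "is_partition a" "num_parts a \<le> N" "is_partition b" "num_parts b \<le> N"
  shows "alternant N (\<lambda>i t. elem_entry y (beads N a i) t) (beads N b) = vertical_weight y a b"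
    "alternant N (\<lambda>j t. elem_entry y t (beads N b j)) (beads N a) = vertical_weight y a b"
  using det1_elem_entry[OF assms, of y] 
    det1_transpose[of N "\<lambda>i j. elem_entry y (beads N a i) (beads N b j)"]
  by (simp_all add: alternant_def)

lemma strip_num_parts_le_add:
  assumes "r \<ge> 1" "strip r e l" shows "num_parts e \<le> num_parts l + r"
proof -
  have e: "is_partition e" and l: "is_partition l" and c: "card (skew e l) = r" 
    using assms by (auto simp: strip_def BS_def)
  have "num_parts e \<le> card ({i. l i \<noteq> 0} \<union> {i. l i < e i})"
    unfolding num_parts_def using l finite_support_diff[OF e] 
    by (intro card_mono) (auto simp: is_partition_def)
  also have "\<dots> \<le> num_parts l + card (fst ` skew e l)"
    unfolding num_parts_def fst_skew[OF e] by (rule card_Un_le)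
  also have "card (fst ` skew e l) \<le> r"
    using card_image_le[OF finite_skew[OF e], of fst l] c by simp
  finally show ?thesis by simp
qed

lemma alternant_upd_transpose:
  "alternant N (\<lambda>j t. f t (b j)) (a(q := v)) = 
   det1 N (\<lambda>i j. if i = q then f v (b j) else f (a i) (b j))"
  unfolding alternant_def
  by (subst det1_transpose[symmetric]) (rule det1_cong, simp)

text \<open>Raising the bead \<open>b\<^sub>j\<close> of the inner partition by \<open>r\<close> changes the entry that depends on
  \<open>a\<^sub>i - b\<^sub>j\<close> in the same way as lowering \<open>a\<^sub>i\<close> by \<open>r\<close>.  Beads \<open>a\<^sub>i < r\<close> cannot be lowered, but
  their rows become zero.\<close>

theorem vertical_weight_remove_commute:
  assumes r: "r \<ge> 1" and a: "is_partition a" and k: "is_partition k"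
  shows "(\<Sum>b | strip r b k. strip_sign b k * vertical_weight y a b) =
    (\<Sum>z | strip r a z. strip_sign a z * vertical_weight y z k)"
proof -
  \<comment> \<open>At most \<open>r\<close> new rows appear when a strip is added, so that \<open>N\<close> beads suffice throughout.\<close>
  define N where "N = max (num_parts a) (num_parts k) + r"
  have N: "num_parts a \<le> N" "num_parts k \<le> N" by (auto simp: N_def)
  let ?E = "elem_entry y" and ?A = "beads N a" and ?K = "beads N k"
  have up: "strip r b k \<and> num_parts b \<le> N \<longleftrightarrow> strip r b k" for b
    using strip_num_parts_le_add[OF r, of b k] by (auto simp: N_def)
  have "(\<Sum>b | strip r b k. strip_sign b k * vertical_weight y a b) = 
    (\<Sum>b | strip r b k \<and> num_parts b \<le> N. 
       strip_sign b k * alternant N (\<lambda>i t. ?E (?A i) t) (beads N b))"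
    unfolding up
  proof (rule sum.cong[OF refl])
    fix b assume "b \<in> {b. strip r b k}"
    then have "is_partition b" "num_parts b \<le> N" using up[of b] by (auto simp: strip_def)
    then show "strip_sign b k * vertical_weight y a b = 
        strip_sign b k * alternant N (\<lambda>i t. ?E (?A i) t) (beads N b)"
      by (simp only: alternant_elem_entry(1)[OF a N(1)])
  qed
  also have "\<dots> = (\<Sum>q = 1..N. alternant N (\<lambda>i t. ?E (?A i) t) (?K(q := ?K q + r)))"
    by (rule alternant_add_strip[OF r k N(2), symmetric])
  also have "\<dots> = (\<Sum>q = 1..N. det1 N (\<lambda>i j. if i = q then ?E (?A i) (?K j + r) else ?E (?A i) (?K j)))"
    unfolding alternant_upd det1_sum_replace_row_eq_column ..
  also have "\<dots> = (\<Sum>q = 1..N. if r \<le> ?A q 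
      then alternant N (\<lambda>j t. ?E t (?K j)) (?A(q := ?A q - r)) else 0)"
  proof (rule sum.cong[OF refl])
    fix q assume q: "q \<in> {1..N}"
    show "det1 N (\<lambda>i j. if i = q then ?E (?A i) (?K j + r) else ?E (?A i) (?K j)) =
      (if r \<le> ?A q then alternant N (\<lambda>j t. ?E t (?K j)) (?A(q := ?A q - r)) else 0)"
    proof (cases "r \<le> ?A q")
      case True
      then have "?E (?A q) (?K j + r) = ?E (?A q - r) (?K j)" for j
        by (auto simp: elem_entry_def)
      then show ?thesis using True unfolding alternant_upd_transpose 
        by (auto intro: det1_cong)
    next
      case False
      then have "det1 N (\<lambda>i j. if i = q then ?E (?A i) (?K j + r) else ?E (?A i) (?K j)) = 0"
        using q by (intro det1_zero_block[of "{q}" N "{}"]) (auto simp: elem_entry_def)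
      then show ?thesis using False by simp
    qed
  qed
  also have "\<dots> = (\<Sum>q | q \<in> {1..N} \<and> r \<le> ?A q. 
      alternant N (\<lambda>j t. ?E t (?K j)) (?A(q := ?A q - r)))"
    by (rule sum.inter_filter[symmetric]) simp
  also have "\<dots> = (\<Sum>z | strip r a z. strip_sign a z * alternant N (\<lambda>j t. ?E t (?K j)) (beads N z))"
    by (rule alternant_remove_strip[OF r a N(1)])
  also have "\<dots> = (\<Sum>z | strip r a z. strip_sign a z * vertical_weight y z k)"
  proof (rule sum.cong[OF refl])
    fix z assume "z \<in> {z. strip r a z}"
    then have "is_partition z" "num_parts z \<le> N" 
      using strip_num_parts[of r a z N] N by (auto simp: strip_def)
    then show "strip_sign a z * alternant N (\<lambda>j t. ?E t (?K j)) (beads N z) = 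
        strip_sign a z * vertical_weight y z k"
      by (simp only: alternant_elem_entry(2)[OF _ _ k N(2)])
  qed
  finally show ?thesis .
qed

text \<open>The column \<open>c\<^sub>t\<close> of \<open>elem_entry\<close> is \<open>u\<^sub>t + y u\<^bsub>t + 1\<^esub>\<close> with \<open>u\<^sub>t\<close> the indicator of \<open>s = t\<close>; solving for
  \<open>u\<^sub>0\<close> gives an alternating sum of the columns \<open>c\<^sub>0, \<dots>, c\<^bsub>r - 1\<^esub>\<close> and a remainder in \<open>u\<^sub>r\<close>.\<close>

lemma unit_column_expansion:
  fixes y :: "'a::field"
  shows "(if s = 0 then 1 else 0) = 
    (\<Sum>t<r. (-y) ^ t * elem_entry y s t) + (-y) ^ r * (if s = r then 1 else 0)"
  by (induction r) (auto simp: elem_entry_def)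

text \<open>As both partitions end in \<open>r\<close> zero parts, their last \<open>r\<close> beads are \<open>r - 1, \<dots>, 0\<close>.  The column
  with bead \<open>r - 1\<close> is replaced by \<open>y u\<^sub>0\<close>, which is expanded by the preceding lemma: the terms
  \<open>c\<^sub>0, \<dots>, c\<^bsub>r - 2\<^esub>\<close> repeat later columns, \<open>c\<^bsub>r - 1\<^esub>\<close> restores the original determinant with the
  coefficient \<open>y (-y)\<^bsup>r - 1\<^esup>\<close>, and with \<open>u\<^sub>r\<close> the last \<open>r\<close> rows live in only \<open>r - 1\<close> columns.\<close>

lemma boundary_column:
  fixes a b :: "nat \<Rightarrow> nat"
  assumes r: "r \<ge> 1" and a: "is_partition a" "num_parts a + r \<le> N" 
    and b: "is_partition b" "num_parts b + r \<le> N"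
  shows "det1 N (replace_column (N + 1 - r) (\<lambda>i. if beads N a i = 0 then y else 0) 
      (\<lambda>i j. elem_entry y (beads N a i) (beads N b j))) = (-1) ^ (r - 1) * y ^ r * vertical_weight y a b"
proof -
  let ?A = "beads N a" and ?B = "beads N b"
  let ?M = "\<lambda>i j. elem_entry y (?A i) (?B j)"
  \<comment> \<open>The first of the last \<open>r\<close> columns; its bead is \<open>r - 1\<close>.\<close>
  define q where "q = N + 1 - r"
  have q: "q \<in> {1..N}" using r a by (auto simp: q_def)
  have tail: "?A i = N - i" "?B i = N - i" if "i \<ge> q" for i
    using that a b num_parts_le_iff[of a "N - r"] num_parts_le_iff[of b "N - r"]
    by (auto simp: beads_def q_def)
  define dt where "dt t = det1 N (replace_column q (\<lambda>i. elem_entry y (?A i) t) ?M)" for t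
  have "det1 N (replace_column q (\<lambda>i. if ?A i = 0 then y else 0) ?M) = 
    det1 N (replace_column q (\<lambda>i. y * ((\<Sum>t\<in>{..<r}. (-y) ^ t * elem_entry y (?A i) t) + 
      (-y) ^ r * (if ?A i = r then 1 else 0))) ?M)"
    unfolding unit_column_expansion[symmetric] by (simp add: if_distrib cong: if_cong)
  also have "\<dots> = y * ((\<Sum>t<r. (-y) ^ t * dt t) + 
      (-y) ^ r * det1 N (replace_column q (\<lambda>i. if ?A i = r then 1 else 0) ?M))"
    unfolding det1_replace_column_scale[OF q] det1_replace_column_add[OF q] 
      det1_replace_column_sum[OF q finite_lessThan] dt_def ..
  also have "det1 N (replace_column q (\<lambda>i. if ?A i = r then 1 else 0) ?M) = 0"
  proof (rule det1_zero_block)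
    show "{q..N} \<subseteq> {1..N}" "{q + 1..N} \<subseteq> {1..N}" using q by auto
    show "card {q + 1..N} < card {q..N}" using q by (simp add: Suc_diff_le)
    fix i j assume ij: "i \<in> {q..N}" "j \<in> {1..N} - {q + 1..N}"
    have "?A i < r" using tail(1)[of i] ij q r by (auto simp: q_def)
    moreover have "r \<le> ?B j" if "j < q" using that r by (auto simp: beads_def q_def)
    ultimately show "replace_column q (\<lambda>i. if ?A i = r then 1 else 0) ?M i j = 0"
      using ij by (cases "j = q") (auto simp: replace_column_def elem_entry_def)
  qed
  also have "(\<Sum>t<r. (-y) ^ t * dt t) = (\<Sum>t\<in>{r - 1}. (-y) ^ t * dt t)"
  proof (rule sum.mono_neutral_right)
    show "\<forall>t\<in>{..<r} - {r - 1}. (-y) ^ t * dt t = 0"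
    proof
      fix t assume t: "t \<in> {..<r} - {r - 1}"
      then have t': "N - t \<ge> q" "N - t \<noteq> q" "N - t \<in> {1..N}" "?B (N - t) = t"
        using tail(2)[of "N - t"] r a by (auto simp: q_def)
      then have "dt t = 0"
        unfolding dt_def by (intro det1_equal_columns[OF q t'(3)]) (auto simp: replace_column_def)
      then show "(-y) ^ t * dt t = 0" by simp
    qed
  qed (use r in auto)
  also have "\<dots> = (-y) ^ (r - 1) * vertical_weight y a b"
  proof -
    have "N - q = r - 1" using r q by (auto simp: q_def)
    then have "?B q = r - 1" using tail(2)[of q] by simp
    then have "dt (r - 1) = det1 N ?M"
      unfolding dt_def by (intro det1_cong) (auto simp: replace_column_def)
    also have "\<dots> = vertical_weight y a b" 
      using a b by (intro det1_elem_entry) auto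
    finally show ?thesis by simp
  qed
  finally show ?thesis
    using r by (cases r) (simp_all add: q_def power_minus[of y] mult_ac)
qed

text \<open>Raising a bead of the outer partition amounts to lowering a bead of the inner one.  The beads
  \<open>b\<^sub>j < r\<close> that cannot be lowered contribute only for \<open>b\<^sub>j = r - 1\<close>, where a single entry \<open>y\<close> in the
  row of the bead \<open>0\<close> remains; this boundary term is what produces the power of \<open>y\<close>.\<close>

theorem vertical_weight_add_commute:
  assumes r: "r \<ge> 1" and a: "is_partition a" and b: "is_partition b"
  shows "(\<Sum>e | strip r e a. strip_sign e a * vertical_weight y e b) =
    (\<Sum>k | strip r b k. strip_sign b k * vertical_weight y a k) + 
    (-1) ^ (r - 1) * y ^ r * vertical_weight y a b"
proof -
  \<comment> \<open>The summand \<open>r\<close> leaves room for added strips and makes the last \<open>r\<close> beads \<open>r - 1, \<dots>, 0\<close>.\<close>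
  define N where "N = max (num_parts a) (num_parts b) + r"
  have N: "num_parts a \<le> N" "num_parts b \<le> N" "num_parts a + r \<le> N" "num_parts b + r \<le> N" 
    by (auto simp: N_def)
  let ?E = "elem_entry y" and ?A = "beads N a" and ?B = "beads N b"
  let ?M = "\<lambda>i j. ?E (?A i) (?B j)"
  have up: "strip r e a \<and> num_parts e \<le> N \<longleftrightarrow> strip r e a" for e
    using strip_num_parts_le_add[OF r, of e a] by (auto simp: N_def)
  \<comment> \<open>The column of the bead \<open>r - 1\<close>.\<close>
  define q0 where "q0 = N + 1 - r"
  have q0: "q0 \<in> {1..N}" using N r by (auto simp: q0_def)
  have Bq0: "?B q0 = r - 1" 
    using num_parts_le_iff[OF b, of "N - r"] N r by (auto simp: beads_def q0_def)
  have "(\<Sum>e | strip r e a. strip_sign e a * vertical_weight y e b) =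
    (\<Sum>e | strip r e a \<and> num_parts e \<le> N. 
       strip_sign e a * alternant N (\<lambda>j t. ?E t (?B j)) (beads N e))"
    unfolding up
  proof (rule sum.cong[OF refl])
    fix e assume "e \<in> {e. strip r e a}"
    then have "is_partition e" "num_parts e \<le> N" using up[of e] by (auto simp: strip_def)
    then show "strip_sign e a * vertical_weight y e b = 
        strip_sign e a * alternant N (\<lambda>j t. ?E t (?B j)) (beads N e)"
      by (simp only: alternant_elem_entry(2)[OF _ _ b N(2)])
  qed
  also have "\<dots> = (\<Sum>q = 1..N. alternant N (\<lambda>j t. ?E t (?B j)) (?A(q := ?A q + r)))"
    by (rule alternant_add_strip[OF r a N(1), symmetric])
  also have "\<dots> = (\<Sum>q = 1..N. det1 N (\<lambda>i j. if i = q then ?E (?A i + r) (?B j) else ?M i j))"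
    unfolding alternant_upd_transpose by (intro sum.cong refl det1_cong) simp
  also have "\<dots> = (\<Sum>q = 1..N. det1 N (replace_column q (\<lambda>i. ?E (?A i + r) (?B q)) ?M))"
    by (rule det1_sum_replace_row_eq_column)
  also have "\<dots> = (\<Sum>q = 1..N. 
     (if r \<le> ?B q then alternant N (\<lambda>i t. ?E (?A i) t) (?B(q := ?B q - r)) else 0) +
     (if q = q0 then det1 N (replace_column q0 (\<lambda>i. if ?A i = 0 then y else 0) ?M) else 0))"
  proof (rule sum.cong[OF refl])
    fix q assume q: "q \<in> {1..N}"
    consider "r \<le> ?B q" "q \<noteq> q0" | "\<not> r \<le> ?B q" "q = q0" | "?B q < r - 1" "q \<noteq> q0"
    proof (cases "r \<le> ?B q")
      case True
      then show ?thesis using that(1) Bq0 r by fastforce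
    next
      case False
      show ?thesis
      proof (cases "q = q0")
        case True
        then show ?thesis using that(2) False by blast
      next
        case neq: False
        then have "?B q \<noteq> ?B q0" 
          using decreasing_le_imp[OF decreasing_beads[OF b], of q N q0] 
            decreasing_le_imp[OF decreasing_beads[OF b], of q0 N q] q q0 by auto
        then show ?thesis using that(3) neq False Bq0 by linarith
      qed
    qed
    then show "det1 N (replace_column q (\<lambda>i. ?E (?A i + r) (?B q)) ?M) = 
     (if r \<le> ?B q then alternant N (\<lambda>i t. ?E (?A i) t) (?B(q := ?B q - r)) else 0) +
     (if q = q0 then det1 N (replace_column q0 (\<lambda>i. if ?A i = 0 then y else 0) ?M) else 0)"
    proof cases
      case 1
      then have "?E (?A i + r) (?B q) = ?E (?A i) (?B q - r)" for i
        by (auto simp: elem_entry_def)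
      then show ?thesis using 1 by (simp add: alternant_upd)
    next
      case 2
      have "?E (?A i + r) (?B q) = (if ?A i = 0 then y else 0)" for i
        using r unfolding 2(2) Bq0 by (auto simp: elem_entry_def)
      then show ?thesis using 2 by simp
    next
      case 3
      then have "?E (?A i + r) (?B q) = 0 * 0" for i
        by (auto simp: elem_entry_def)
      then show ?thesis using 3 by (simp only: det1_replace_column_scale[OF q]) simp
    qed
  qed
  also have "\<dots> = (\<Sum>q = 1..N. if r \<le> ?B q then alternant N (\<lambda>i t. ?E (?A i) t) (?B(q := ?B q - r)) else 0) +
     det1 N (replace_column q0 (\<lambda>i. if ?A i = 0 then y else 0) ?M)"
    using q0 by (simp add: sum.distrib)
  also have "(\<Sum>q = 1..N. if r \<le> ?B q then alternant N (\<lambda>i t. ?E (?A i) t) (?B(q := ?B q - r)) else 0) =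
    (\<Sum>q | q \<in> {1..N} \<and> r \<le> ?B q. alternant N (\<lambda>i t. ?E (?A i) t) (?B(q := ?B q - r)))"
    by (rule sum.inter_filter[symmetric]) simp
  also have "\<dots> = (\<Sum>k | strip r b k. strip_sign b k * alternant N (\<lambda>i t. ?E (?A i) t) (beads N k))"
    by (rule alternant_remove_strip[OF r b N(2)])
  also have "\<dots> = (\<Sum>k | strip r b k. strip_sign b k * vertical_weight y a k)"
  proof (rule sum.cong[OF refl])
    fix k assume "k \<in> {k. strip r b k}"
    then have "is_partition k" "num_parts k \<le> N" 
      using strip_num_parts[of r b k N] N by (auto simp: strip_def)
    then show "strip_sign b k * alternant N (\<lambda>i t. ?E (?A i) t) (beads N k) = 
        strip_sign b k * vertical_weight y a k"
      by (simp only: alternant_elem_entry(1)[OF a N(1)])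
  qed
  also have "det1 N (replace_column q0 (\<lambda>i. if ?A i = 0 then y else 0) ?M) = 
     (-1) ^ (r - 1) * y ^ r * vertical_weight y a b"
    unfolding q0_def by (rule boundary_column[OF r a N(3) b N(4)])
  finally show ?thesis .
qed

section \<open>Chains of vertical strips\<close>

definition num_boxes :: "(nat \<Rightarrow> nat) \<Rightarrow> nat" where
  "num_boxes l = card (diagram l)"

text \<open>A finite set of partitions that contains all partitions occurring in the final computation, so
  that sums over strips become products of finite matrices.\<close>

definition partitions_upto :: "nat \<Rightarrow> (nat \<Rightarrow> nat) set" where
  "partitions_upto K = {l. is_partition l \<and> num_boxes l \<le> K}"

lemma finite_diagram: "is_partition l \<Longrightarrow> finite (diagram l)"
proof -
  assume l: "is_partition l"
  have "diagram l = skew l (\<lambda>_. 0)" by (auto simp: skew_def diagram_def)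
  then show ?thesis using finite_skew[OF l] by simp
qed

lemma diagram_inj: "is_partition l \<Longrightarrow> is_partition e \<Longrightarrow> diagram l = diagram e \<Longrightarrow> l = e"
  using diagram_subset_iff[of l e] diagram_subset_iff[of e l] by (auto intro!: ext le_antisym)

lemma num_boxes_mono: "is_partition e \<Longrightarrow> diagram l \<subseteq> diagram e \<Longrightarrow> num_boxes l \<le> num_boxes e"
  unfolding num_boxes_def by (rule card_mono[OF finite_diagram])

lemma num_boxes_strip: 
  assumes "strip r e l" shows "num_boxes e = num_boxes l + r"
proof -
  have "card (diagram e - diagram l) = card (diagram e) - card (diagram l)"
    "card (diagram l) \<le> card (diagram e)"
    using assms finite_diagram[of l] finite_diagram[of e] 
    by (auto simp: strip_def intro: card_Diff_subset card_mono)
  then show ?thesis using assms by (auto simp: strip_def num_boxes_def BS_def skew_def)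
qed

lemma finite_partitions_upto: "finite (partitions_upto K)"
proof -
  have "diagram l \<subseteq> {1..K} \<times> {1..K}" if l: "l \<in> partitions_upto K" for l
  proof
    fix b assume "b \<in> diagram l"
    then obtain i j where b: "b = (i, j)" "1 \<le> i" "1 \<le> j" "j \<le> l i" by (auto simp: diagram_def)
    have p: "is_partition l" "card (diagram l) \<le> K" using l by (auto simp: partitions_upto_def num_boxes_def)
    have "{1..i} \<times> {j} \<subseteq> diagram l"
      using partition_antimono[OF p(1), of _ i] b by (force simp: diagram_def)
    then have "card ({1..i} \<times> {j}) \<le> card (diagram l)" by (rule card_mono[OF finite_diagram[OF p(1)]])
    moreover have "{i} \<times> {1..j} \<subseteq> diagram l" using b by (auto simp: diagram_def)
    then have "card ({i} \<times> {1..j}) \<le> card (diagram l)" by (rule card_mono[OF finite_diagram[OF p(1)]])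
    ultimately show "b \<in> {1..K} \<times> {1..K}" using p b by (simp add: card_cartesian_product)
  qed
  then have "diagram ` partitions_upto K \<subseteq> Pow ({1..K} \<times> {1..K})" by auto
  then have "finite (diagram ` partitions_upto K)" by (rule finite_subset) simp
  moreover have "inj_on diagram (partitions_upto K)"
    by (auto intro!: inj_onI diagram_inj simp: partitions_upto_def)
  ultimately show ?thesis by (rule finite_imageD)
qed

lemma partitions_upto_subset:
  "e \<in> partitions_upto K \<Longrightarrow> is_partition l \<Longrightarrow> diagram l \<subseteq> diagram e \<Longrightarrow> l \<in> partitions_upto K"
  using num_boxes_mono[of e l] by (auto simp: partitions_upto_def)

lemma vertical_strip_subset: "is_partition b \<Longrightarrow> vertical_strip a b \<Longrightarrow> diagram b \<subseteq> diagram a"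
  unfolding vertical_strip_def using diagram_subset_iff[of b a] by (metis le_refl le_Suc_eq)

text \<open>The total weight of the chains from \<open>b\<close> to \<open>a\<close> in which the \<open>j\<close>-th step is a vertical strip whose boxes
  carry the variable \<open>y j\<close>.\<close>

fun chain_weight :: "(nat \<Rightarrow> 'a::field) \<Rightarrow> nat \<Rightarrow> (nat \<Rightarrow> nat) \<Rightarrow> (nat \<Rightarrow> nat) \<Rightarrow> 'a" where
  "chain_weight y 0 a b = (if a = b then 1 else 0)"
| "chain_weight y (Suc m) a b = 
     (\<Sum>c | is_partition c \<and> vertical_strip a c. vertical_weight (y (Suc m)) a c * chain_weight y m c b)"

lemma chain_weight_Suc_upto:
  assumes a: "a \<in> partitions_upto K"
  shows "chain_weight y (Suc m) a b = 
     (\<Sum>c\<in>partitions_upto K. vertical_weight (y (Suc m)) a c * chain_weight y m c b)"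
proof -
  have "(\<Sum>c | is_partition c \<and> vertical_strip a c. vertical_weight (y (Suc m)) a c * chain_weight y m c b) =
     (\<Sum>c\<in>partitions_upto K. vertical_weight (y (Suc m)) a c * chain_weight y m c b)"
    using partitions_upto_subset[OF a] vertical_strip_subset[of _ a]
    by (intro sum.mono_neutral_left finite_partitions_upto)
       (auto simp: vertical_weight_def partitions_upto_def)
  then show ?thesis by simp
qed

lemma chain_weight_eq_0:
  "is_partition a \<Longrightarrow> is_partition b \<Longrightarrow> \<not> diagram b \<subseteq> diagram a \<Longrightarrow> chain_weight y m a b = 0"
proof (induction m arbitrary: a)
  case (Suc m)
  have "chain_weight y m c b = 0" if "is_partition c" "vertical_strip a c" for c
    using that Suc vertical_strip_subset[of c a] by blast
  then show ?case by simp
qed auto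

definition strip_matrix :: "nat \<Rightarrow> (nat \<Rightarrow> nat) \<Rightarrow> (nat \<Rightarrow> nat) \<Rightarrow> 'a::comm_ring_1" where
  "strip_matrix r e l = (if strip r e l then strip_sign e l else 0)"

lemma sum_strip_matrix_down:
  assumes "e \<in> partitions_upto K"
  shows "(\<Sum>l | strip r e l. strip_sign e l * f l) = (\<Sum>l\<in>partitions_upto K. strip_matrix r e l * f l)"
  using partitions_upto_subset[OF assms]
  by (intro sum.mono_neutral_cong_left finite_partitions_upto) (auto simp: strip_matrix_def strip_def)

lemma sum_strip_matrix_up:
  assumes "\<And>e. strip r e l \<Longrightarrow> e \<notin> partitions_upto K \<Longrightarrow> f e = 0"
  shows "(\<Sum>e | strip r e l. strip_sign e l * f e) = (\<Sum>e\<in>partitions_upto K. strip_matrix r e l * f e)"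
proof -
  have "finite {e. strip r e l}"
    by (rule finite_subset[OF _ finite_partitions_upto[of "num_boxes l + r"]])
       (auto simp: num_boxes_strip partitions_upto_def strip_def)
  then have "(\<Sum>e | strip r e l. strip_sign e l * f e) = 
      (\<Sum>e\<in>{e. strip r e l} \<inter> partitions_upto K. strip_sign e l * f e)"
    using assms by (intro sum.mono_neutral_right) auto
  also have "\<dots> = (\<Sum>e\<in>partitions_upto K. strip_matrix r e l * f e)"
    by (intro sum.mono_neutral_cong_left finite_partitions_upto) (auto simp: strip_matrix_def)
  finally show ?thesis .
qed

lemma strip_in_partitions_upto: "strip r e l \<Longrightarrow> num_boxes l + r \<le> K \<Longrightarrow> e \<in> partitions_upto K"
  using num_boxes_strip[of r e l] by (simp add: partitions_upto_def strip_def)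

text \<open>Associativity of the product row vector times matrix times column vector.\<close>

lemma sum_matrix_assoc:
  fixes f :: "'b \<Rightarrow> 'a::comm_ring_1"
  shows "(\<Sum>i\<in>A. f i * (\<Sum>j\<in>B. g i j * h j)) = (\<Sum>j\<in>B. (\<Sum>i\<in>A. f i * g i j) * h j)"
  unfolding sum_distrib_left sum_distrib_right by (subst sum.swap) (simp add: mult.assoc)

text \<open>Removing border strips commutes with each single step of a chain, hence with the whole chain.\<close>

theorem chain_weight_remove_commute:
  assumes r: "r \<ge> 1" and a: "a \<in> partitions_upto K" and k: "k \<in> partitions_upto K"
  shows "(\<Sum>b\<in>partitions_upto K. strip_matrix r b k * chain_weight y m a b) = 
    (\<Sum>z\<in>partitions_upto K. strip_matrix r a z * chain_weight y m z k)"
  using a k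
proof (induction m arbitrary: a k)
  case 0
  then show ?case using finite_partitions_upto[of K] 
    by (simp add: if_distrib[of "(*) _"] cong: if_cong)
next
  case (Suc m)
  let ?P = "partitions_upto K" and ?V = "vertical_weight (y (Suc m))" and ?R = "strip_matrix r"
  have one: "(\<Sum>c\<in>?P. ?R c z * ?V a c) = (\<Sum>d\<in>?P. ?R a d * ?V d z)" if z: "z \<in> ?P" for z
  proof -
    have "(\<Sum>c\<in>?P. ?R c z * ?V a c) = (\<Sum>c | strip r c z. strip_sign c z * ?V a c)"
      using partitions_upto_subset[OF Suc.prems(1)] vertical_strip_subset[of _ a]
      by (intro sum_strip_matrix_up[symmetric]) (auto simp: vertical_weight_def strip_def)
    also have "\<dots> = (\<Sum>d | strip r a d. strip_sign a d * ?V d z)"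
      using Suc.prems z by (intro vertical_weight_remove_commute r) (auto simp: partitions_upto_def)
    also have "\<dots> = (\<Sum>d\<in>?P. ?R a d * ?V d z)" by (rule sum_strip_matrix_down[OF Suc.prems(1)])
    finally show ?thesis .
  qed
  have "(\<Sum>b\<in>?P. ?R b k * chain_weight y (Suc m) a b) = 
    (\<Sum>b\<in>?P. ?R b k * (\<Sum>c\<in>?P. chain_weight y m c b * ?V a c))"
    by (simp only: chain_weight_Suc_upto[OF Suc.prems(1)] mult.commute)
  also have "\<dots> = (\<Sum>c\<in>?P. (\<Sum>b\<in>?P. ?R b k * chain_weight y m c b) * ?V a c)"
    by (rule sum_matrix_assoc)
  also have "\<dots> = (\<Sum>c\<in>?P. ?V a c * (\<Sum>z\<in>?P. ?R c z * chain_weight y m z k))"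
    using Suc.IH[OF _ Suc.prems(2)] by (intro sum.cong refl) (simp add: mult.commute)
  also have "\<dots> = (\<Sum>z\<in>?P. (\<Sum>c\<in>?P. ?V a c * ?R c z) * chain_weight y m z k)"
    by (rule sum_matrix_assoc)
  also have "\<dots> = (\<Sum>z\<in>?P. (\<Sum>d\<in>?P. ?R a d * ?V d z) * chain_weight y m z k)"
    by (intro sum.cong refl) (simp add: one[symmetric] mult.commute)
  also have "\<dots> = (\<Sum>d\<in>?P. ?R a d * (\<Sum>z\<in>?P. ?V d z * chain_weight y m z k))"
    by (rule sum_matrix_assoc[symmetric])
  also have "\<dots> = (\<Sum>d\<in>?P. ?R a d * chain_weight y (Suc m) d k)"
    by (intro sum.cong refl) (simp add: chain_weight_Suc_upto del: chain_weight.simps)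
  finally show ?case .
qed

text \<open>Moving the addition of border strips through a chain picks up one boundary term
  \<open>(-1)\<^bsup>r - 1\<^esup> y\<^sub>j\<^sup>r\<close> at every step; together they form the power sum.  The bound on the number of
  boxes of \<open>a\<close> keeps all partitions obtained by adding a strip within the finite set.\<close>

theorem chain_weight_add_commute:
  assumes r: "r \<ge> 1" and a: "a \<in> partitions_upto K" "num_boxes a + r \<le> K" and b: "b \<in> partitions_upto K"
  shows "(\<Sum>e\<in>partitions_upto K. strip_matrix r e a * chain_weight y m e b) = 
    (\<Sum>k\<in>partitions_upto K. strip_matrix r b k * chain_weight y m a k) +
    (-1) ^ (r - 1) * (\<Sum>j = 1..m. y j ^ r) * chain_weight y m a b"
  using a b
proof (induction m arbitrary: a b)
  case 0
  then show ?case using finite_partitions_upto[of K] 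
    by (simp add: if_distrib[of "(*) _"] cong: if_cong)
next
  case (Suc m)
  let ?P = "partitions_upto K" and ?V = "vertical_weight (y (Suc m))" and ?R = "strip_matrix r"
  let ?W = "chain_weight y m" and ?s = "(-1 :: 'a) ^ (r - 1)"
  have one: "(\<Sum>e\<in>?P. ?R e a * ?V e c) = (\<Sum>k\<in>?P. ?R c k * ?V a k) + ?s * y (Suc m) ^ r * ?V a c"
    if c: "c \<in> ?P" for c
  proof -
    have "(\<Sum>e\<in>?P. ?R e a * ?V e c) = (\<Sum>e | strip r e a. strip_sign e a * ?V e c)"
      using strip_in_partitions_upto[OF _ Suc.prems(2)] by (intro sum_strip_matrix_up[symmetric]) auto
    also have "\<dots> = (\<Sum>k | strip r c k. strip_sign c k * ?V a k) + ?s * y (Suc m) ^ r * ?V a c"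
      using Suc.prems c by (intro vertical_weight_add_commute r) (auto simp: partitions_upto_def)
    finally show ?thesis by (simp only: sum_strip_matrix_down[OF c])
  qed
  \<comment> \<open>For \<open>\<not> vertical_strip a k\<close> the induction hypothesis may fail to apply, but the factor is zero.\<close>
  have IH: "?V a k * (\<Sum>c\<in>?P. ?R c k * ?W c b) = 
      ?V a k * ((\<Sum>l\<in>?P. ?R b l * ?W k l) + ?s * (\<Sum>j = 1..m. y j ^ r) * ?W k b)" if k: "k \<in> ?P" for k
  proof (cases "vertical_strip a k")
    case True
    have "num_boxes k \<le> num_boxes a" 
      using True k Suc.prems vertical_strip_subset[of k a] 
      by (intro num_boxes_mono) (auto simp: partitions_upto_def)
    then show ?thesis using Suc.prems by (simp add: Suc.IH[OF k _ Suc.prems(3)])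
  next
    case False
    then show ?thesis by (simp add: vertical_weight_def)
  qed
  have "(\<Sum>e\<in>?P. ?R e a * chain_weight y (Suc m) e b) = 
     (\<Sum>e\<in>?P. ?R e a * (\<Sum>c\<in>?P. ?V e c * ?W c b))"
    by (intro sum.cong refl) (simp only: chain_weight_Suc_upto)
  also have "\<dots> = (\<Sum>c\<in>?P. (\<Sum>e\<in>?P. ?R e a * ?V e c) * ?W c b)"
    by (rule sum_matrix_assoc)
  also have "\<dots> = (\<Sum>c\<in>?P. (\<Sum>k\<in>?P. ?V a k * ?R c k) * ?W c b) + 
      ?s * y (Suc m) ^ r * (\<Sum>c\<in>?P. ?V a c * ?W c b)"
  proof -
    have "(\<Sum>e\<in>?P. ?R e a * ?V e c) * ?W c b = (\<Sum>k\<in>?P. ?V a k * ?R c k) * ?W c b + 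
        ?s * y (Suc m) ^ r * (?V a c * ?W c b)" if "c \<in> ?P" for c
      unfolding one[OF that] by (simp add: distrib_right mult.assoc mult.commute[of "?R _ _"])
    then show ?thesis by (simp add: sum.distrib sum_distrib_left)
  qed
  also have "(\<Sum>c\<in>?P. (\<Sum>k\<in>?P. ?V a k * ?R c k) * ?W c b) = 
      (\<Sum>k\<in>?P. ?V a k * (\<Sum>c\<in>?P. ?R c k * ?W c b))"
    by (rule sum_matrix_assoc[symmetric])
  also have "\<dots> = (\<Sum>k\<in>?P. ?V a k * (\<Sum>l\<in>?P. ?W k l * ?R b l)) + 
      ?s * (\<Sum>j = 1..m. y j ^ r) * (\<Sum>c\<in>?P. ?V a c * ?W c b)"
  proof -
    have "?V a k * (\<Sum>c\<in>?P. ?R c k * ?W c b) = ?V a k * (\<Sum>l\<in>?P. ?W k l * ?R b l) + 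
        ?s * (\<Sum>j = 1..m. y j ^ r) * (?V a k * ?W k b)" if "k \<in> ?P" for k
      unfolding IH[OF that] by (simp add: distrib_left mult.left_commute mult.commute[of "?R _ _"])
    then show ?thesis 
      by (simp only: sum.distrib sum_distrib_left[where r = "?s * (\<Sum>j = 1..m. y j ^ r)"] cong: sum.cong)
  qed
  also have "(\<Sum>k\<in>?P. ?V a k * (\<Sum>l\<in>?P. ?W k l * ?R b l)) = 
      (\<Sum>l\<in>?P. (\<Sum>k\<in>?P. ?V a k * ?W k l) * ?R b l)"
    by (rule sum_matrix_assoc)
  also have "\<dots> = (\<Sum>l\<in>?P. ?R b l * chain_weight y (Suc m) a l)"
    by (simp only: chain_weight_Suc_upto[OF Suc.prems(1)] mult.commute)
  also have "(\<Sum>c\<in>?P. ?V a c * ?W c b) = chain_weight y (Suc m) a b"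
    by (simp only: chain_weight_Suc_upto[OF Suc.prems(1)])
  finally show ?case by (simp add: algebra_simps del: chain_weight.simps)
qed


section \<open>Tableaux of conjugate shape\<close>

lemma diagram_conj: 
  assumes "is_partition l"
  shows "(j, i) \<in> diagram (conj_partition l) \<longleftrightarrow> (i, j) \<in> diagram l"
proof (cases "1 \<le> i \<and> 1 \<le> j")
  case True
  define C where "C = {i. 1 \<le> i \<and> j \<le> l i}"
  have C: "conj_partition l j = card C" 
    unfolding conj_partition_def C_def diagram_def using True by simp
  have fin: "finite C"
    by (rule finite_subset[of _ "{i. l i \<noteq> 0}"]) (use assms True in \<open>auto simp: C_def is_partition_def\<close>)
  have down: "{1..k} \<subseteq> C" if "k \<in> C" for k
    using that partition_antimono[OF assms, of _ k] by (force simp: C_def)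
  have "i \<le> card C \<longleftrightarrow> i \<in> C"
  proof
    assume "i \<in> C"
    then show "i \<le> card C" using card_mono[OF fin down[of i]] by simp
  next
    assume le: "i \<le> card C"
    show "i \<in> C"
    proof (rule ccontr)
      assume "i \<notin> C"
      then have "C \<subseteq> {1..<i}" using down True by (force simp: C_def not_le[symmetric] subset_iff)
      then have "card C \<le> i - 1" using card_mono[of "{1..<i}" C] by simp
      then show False using le True by linarith
    qed
  qed
  then show ?thesis using True C by (auto simp: diagram_def C_def)
qed (auto simp: diagram_def)

lemma skew_conj: "is_partition a \<Longrightarrow> is_partition b \<Longrightarrow>
    (j, i) \<in> skew (conj_partition a) (conj_partition b) \<longleftrightarrow> (i, j) \<in> skew a b"
  unfolding skew_def by (simp add: diagram_conj)

text \<open>In the conjugate shape a box \<open>(j, i)\<close> comes from column \<open>j\<close> of row \<open>i\<close>.  A semistandard tableau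
  on it is, seen in the original shape, strictly increasing along rows and weakly increasing down
  columns.\<close>

definition conj_skew :: "(nat \<Rightarrow> nat) \<Rightarrow> (nat \<Rightarrow> nat) \<Rightarrow> (nat \<times> nat) set" where
  "conj_skew a b = skew (conj_partition a) (conj_partition b)"

lemma mem_conj_skew: "is_partition a \<Longrightarrow> is_partition b \<Longrightarrow> 
    (j, i) \<in> conj_skew a b \<longleftrightarrow> 1 \<le> i \<and> b i < j \<and> j \<le> a i"
  unfolding conj_skew_def by (simp only: skew_conj) (simp only: mem_skew)

lemma finite_card_conj_skew: 
  assumes "is_partition a" "is_partition b"
  shows "finite (conj_skew a b)" "card (conj_skew a b) = card (skew a b)"
proof -
  have eq: "conj_skew a b = prod.swap ` skew a b"
    by (auto simp: conj_skew_def skew_conj[OF assms])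
  show "finite (conj_skew a b)" unfolding eq using finite_skew[OF assms(1)] by simp
  show "card (conj_skew a b) = card (skew a b)" unfolding eq by (rule card_image) simp
qed

definition tab_weight :: "(nat \<Rightarrow> 'a::field) \<Rightarrow> nat \<Rightarrow> (nat \<times> nat) set \<Rightarrow> (nat \<times> nat \<Rightarrow> nat) \<Rightarrow> 'a" where
  "tab_weight y m S T = (\<Prod>j = 1..m. y j ^ card {x \<in> S. T x = j})"

lemma skew_schur_conj:
  "skew_schur m y (conj_partition a) (conj_partition b) = (\<Sum>T\<in>ssyt m (conj_skew a b). tab_weight y m (conj_skew a b) T)"
  by (simp add: skew_schur_def conj_skew_def tab_weight_def)

lemma ssytD:
  assumes "T \<in> ssyt m S"
  shows "T \<in> S \<rightarrow>\<^sub>E {1..m}" "(i, j) \<in> S \<Longrightarrow> (i, l) \<in> S \<Longrightarrow> j < l \<Longrightarrow> T (i, j) \<le> T (i, l)"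
    "(i, j) \<in> S \<Longrightarrow> (k, j) \<in> S \<Longrightarrow> i < k \<Longrightarrow> T (i, j) < T (k, j)"
  using assms by (auto simp: ssyt_def)

lemma ssytI:
  assumes "T \<in> S \<rightarrow>\<^sub>E {1..m}" 
    "\<And>i j l. (i, j) \<in> S \<Longrightarrow> (i, l) \<in> S \<Longrightarrow> j < l \<Longrightarrow> T (i, j) \<le> T (i, l)"
    "\<And>i j k. (i, j) \<in> S \<Longrightarrow> (k, j) \<in> S \<Longrightarrow> i < k \<Longrightarrow> T (i, j) < T (k, j)"
  shows "T \<in> ssyt m S"
  using assms by (auto simp: ssyt_def)

lemma finite_ssyt: "finite S \<Longrightarrow> finite (ssyt m S)"
  by (rule finite_subset[of _ "S \<rightarrow>\<^sub>E {1..m}"]) (auto simp: ssyt_def intro: finite_PiE)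

text \<open>The outer partition that remains after deleting the boxes with the largest entry \<open>Suc m\<close>.  Each
  row of the original shape is strictly increasing and so loses at most its last box.\<close>

definition shrink :: "nat \<Rightarrow> (nat \<Rightarrow> nat) \<Rightarrow> (nat \<Rightarrow> nat) \<Rightarrow> (nat \<times> nat \<Rightarrow> nat) \<Rightarrow> nat \<Rightarrow> nat" where
  "shrink m a b T i = (if b i < a i \<and> T (a i, i) = Suc m then a i - 1 else a i)"

text \<open>The inverse operation: the boxes of \<open>a / c\<close> are filled with \<open>Suc m\<close>.\<close>

definition extend :: "nat \<Rightarrow> (nat \<Rightarrow> nat) \<Rightarrow> (nat \<Rightarrow> nat) \<Rightarrow> (nat \<Rightarrow> nat) \<Rightarrow> (nat \<times> nat \<Rightarrow> nat) \<Rightarrow> nat \<times> nat \<Rightarrow> nat" where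
  "extend m a b c T = restrict (\<lambda>x. if x \<in> conj_skew c b then T x else Suc m) (conj_skew a b)"

context
  fixes a b :: "nat \<Rightarrow> nat" and m :: nat
  assumes a: "is_partition a" and b: "is_partition b" and le: "\<And>i. b i \<le> a i"
begin

lemma shrink:
  assumes T: "T \<in> ssyt (Suc m) (conj_skew a b)"
  shows "is_partition (shrink m a b T)" "vertical_strip a (shrink m a b T)" 
    "b i \<le> shrink m a b T i" 
    "x \<in> conj_skew a b \<Longrightarrow> x \<in> conj_skew (shrink m a b T) b \<longleftrightarrow> T x \<le> m"
    "restrict T (conj_skew (shrink m a b T) b) \<in> ssyt m (conj_skew (shrink m a b T) b)"
proof -
  let ?c = "shrink m a b T"
  note D = ssytD[OF T]
  have val: "T x \<in> {1..Suc m}" if "x \<in> conj_skew a b" for x using D(1) that by blast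
  have ca: "?c i \<le> a i" "a i \<le> Suc (?c i)" for i by (auto simp: shrink_def)
  have step: "?c (Suc i) \<le> ?c i" if i: "i \<ge> 1" for i
  proof (cases "b i < a i \<and> T (a i, i) = Suc m \<and> a (Suc i) = a i")
    case False
    then show ?thesis using partition_Suc[OF a i] by (auto simp: shrink_def)
  next
    case True
    have "b (Suc i) < a (Suc i)" using True partition_Suc[OF b i] by simp
    moreover have "T (a i, i) \<le> T (a i, Suc i)"
      using True i calculation by (intro D(2)) (auto simp: mem_conj_skew a b)
    moreover have "T (a i, Suc i) \<in> {1..Suc m}"
      using True i calculation(1) by (intro val) (auto simp: mem_conj_skew a b)
    ultimately show ?thesis using True by (auto simp: shrink_def)
  qed
  show c: "is_partition ?c"
    unfolding is_partition_def
  proof (intro conjI allI impI)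
    show "?c 0 = 0" using ca(1)[of 0] partition_0[OF a] by simp
    show "?c (Suc i) \<le> ?c i" if "1 \<le> i" for i using step that .
    show "finite {i. ?c i \<noteq> 0}"
    proof (rule finite_subset)
      show "{i. ?c i \<noteq> 0} \<subseteq> {i. a i \<noteq> 0}"
      proof
        fix i assume "i \<in> {i. ?c i \<noteq> 0}"
        then show "i \<in> {i. a i \<noteq> 0}" using ca(1)[of i] by simp
      qed
      show "finite {i. a i \<noteq> 0}" using a unfolding is_partition_def by blast
    qed
  qed
  show "vertical_strip a ?c" 
    unfolding vertical_strip_def
  proof
    fix i show "a i = ?c i \<or> a i = Suc (?c i)" using ca[of i] by linarith
  qed
  show "b i \<le> ?c i" for i using le[of i] by (auto simp: shrink_def)
  show mem: "x \<in> conj_skew ?c b \<longleftrightarrow> T x \<le> m" if x: "x \<in> conj_skew a b" for x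
  proof -
    obtain j i where ji: "x = (j, i)" by (cases x)
    then have x': "1 \<le> i" "b i < j" "j \<le> a i" using x by (auto simp: mem_conj_skew a b)
    have iff: "x \<in> conj_skew ?c b \<longleftrightarrow> j \<le> ?c i" using x' ji by (simp add: mem_conj_skew c b)
    show ?thesis
    proof (cases "j = a i")
      case True
      then show ?thesis using x' val[OF x] unfolding iff unfolding ji by (auto simp: shrink_def)
    next
      case False
      then have "T x < T (a i, i)" using x' ji x unfolding ji by (intro D(3)) (auto simp: mem_conj_skew a b)
      moreover have "T (a i, i) \<in> {1..Suc m}" using x' by (intro val) (auto simp: mem_conj_skew a b)
      ultimately show ?thesis using False x' ca(2)[of i] unfolding iff by auto
    qed
  qed
  have sub: "conj_skew ?c b \<subseteq> conj_skew a b"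
    by (auto simp: mem_conj_skew a b c intro: order_trans[OF _ ca(1)])
  show "restrict T (conj_skew ?c b) \<in> ssyt m (conj_skew ?c b)"
  proof (rule ssytI)
    show "restrict T (conj_skew ?c b) \<in> conj_skew ?c b \<rightarrow>\<^sub>E {1..m}"
      unfolding restrict_PiE_iff
    proof
      fix x assume "x \<in> conj_skew ?c b"
      then show "T x \<in> {1..m}" using sub val[of x] mem[of x] by auto
    qed
  next
    fix i j l assume ij: "(i, j) \<in> conj_skew ?c b" "(i, l) \<in> conj_skew ?c b" "j < l"
    then show "restrict T (conj_skew ?c b) (i, j) \<le> restrict T (conj_skew ?c b) (i, l)"
      using D(2)[of i j l] subsetD[OF sub] by simp
  next
    fix i j k assume ij: "(i, j) \<in> conj_skew ?c b" "(k, j) \<in> conj_skew ?c b" "i < k"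
    then show "restrict T (conj_skew ?c b) (i, j) < restrict T (conj_skew ?c b) (k, j)"
      using D(3)[of i j k] subsetD[OF sub] by simp
  qed
qed

context
  fixes c :: "nat \<Rightarrow> nat"
  assumes c: "is_partition c" and vs: "vertical_strip a c" and bc: "\<And>i. b i \<le> c i"
begin

lemma conj_skew_sub: "conj_skew c b \<subseteq> conj_skew a b" "conj_skew a c = conj_skew a b - conj_skew c b"
proof -
  have ca: "c i \<le> a i" for i using vs[unfolded vertical_strip_def, rule_format, of i] by auto
  show "conj_skew c b \<subseteq> conj_skew a b" "conj_skew a c = conj_skew a b - conj_skew c b"
    by (auto simp: mem_conj_skew a b c intro: order_trans[OF _ ca] le_less_trans[OF bc])
qed

lemma extend:
  assumes T: "T \<in> ssyt m (conj_skew c b)"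
  shows "extend m a b c T \<in> ssyt (Suc m) (conj_skew a b)" "shrink m a b (extend m a b c T) = c"
    "restrict (extend m a b c T) (conj_skew c b) = T"
    "tab_weight y (Suc m) (conj_skew a b) (extend m a b c T) = 
      vertical_weight (y (Suc m)) a c * tab_weight y m (conj_skew c b) T"
proof -
  note D = ssytD[OF T]
  let ?T = "extend m a b c T"
  have val: "T x \<in> {1..m}" if "x \<in> conj_skew c b" for x using D(1) that by blast
  have ca: "c i \<le> a i" "a i \<le> Suc (c i)" for i 
    using vs[unfolded vertical_strip_def, rule_format, of i] by auto
  have ext: "?T x = (if x \<in> conj_skew c b then T x else Suc m)" if "x \<in> conj_skew a b" for x
    using that by (simp add: extend_def)
  show "?T \<in> ssyt (Suc m) (conj_skew a b)"
  proof (rule ssytI)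
    show "?T \<in> conj_skew a b \<rightarrow>\<^sub>E {1..Suc m}"
      using val by (fastforce simp: extend_def)
  next
    fix i j l assume ij: "(i, j) \<in> conj_skew a b" "(i, l) \<in> conj_skew a b" "j < l"
    show "?T (i, j) \<le> ?T (i, l)"
    proof (cases "(i, l) \<in> conj_skew c b")
      case True
      moreover have "c l \<le> c j" using ij by (intro partition_antimono[OF c]) (auto simp: mem_conj_skew a b)
      ultimately have "(i, j) \<in> conj_skew c b" using ij by (auto simp: mem_conj_skew a b c)
      then show ?thesis using True D(2)[OF _ True ij(3)] ij by (simp add: ext)
    next
      case False
      then show ?thesis using ij val[of "(i, j)"] by (auto simp: ext)
    qed
  next
    fix i j k assume ik: "(i, j) \<in> conj_skew a b" "(k, j) \<in> conj_skew a b" "i < k"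
    have mem: "(i, j) \<in> conj_skew c b" using ik ca(2)[of j] by (auto simp: mem_conj_skew a b c)
    show "?T (i, j) < ?T (k, j)"
    proof (cases "(k, j) \<in> conj_skew c b")
      case True
      then show ?thesis using D(3)[OF mem True ik(3)] ik mem by (simp add: ext)
    next
      case False
      then show ?thesis using mem ik val[OF mem] by (simp add: ext)
    qed
  qed
  show "shrink m a b ?T = c"
  proof
    fix i
    show "shrink m a b ?T i = c i"
    proof (cases "b i < a i")
      case False
      then show ?thesis using bc[of i] ca[of i] by (simp add: shrink_def)
    next
      case True
      then have "i \<noteq> 0" using partition_0[OF a] by (cases i) auto
      then have mem: "(a i, i) \<in> conj_skew a b" using True by (simp add: mem_conj_skew a b)
      have "(a i, i) \<in> conj_skew c b \<longleftrightarrow> a i = c i" 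
        using True \<open>i \<noteq> 0\<close> ca[of i] by (auto simp: mem_conj_skew c b)
      then have "?T (a i, i) = Suc m \<longleftrightarrow> a i \<noteq> c i"
        using ext[OF mem] val[of "(a i, i)"] by auto
      then show ?thesis using True ca[of i] by (auto simp: shrink_def)
    qed
  qed
  show "restrict ?T (conj_skew c b) = T"
    using D(1) conj_skew_sub(1) by (auto simp: fun_eq_iff ext restrict_def PiE_def extensional_def)
  have "{x \<in> conj_skew a b. ?T x = j} = {x \<in> conj_skew c b. T x = j}" if "j \<in> {1..m}" for j
    using that conj_skew_sub(1) by (auto simp: ext split: if_splits)
  then have "tab_weight y m (conj_skew a b) ?T = tab_weight y m (conj_skew c b) T"
    unfolding tab_weight_def by (intro prod.cong refl) simp
  moreover have "{x \<in> conj_skew a b. ?T x = Suc m} = conj_skew a c"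
    unfolding conj_skew_sub(2) using val by (fastforce simp: ext)
  ultimately show "tab_weight y (Suc m) (conj_skew a b) ?T = 
      vertical_weight (y (Suc m)) a c * tab_weight y m (conj_skew c b) T"
    using vs finite_card_conj_skew(2)[OF a c] by (simp add: tab_weight_def vertical_weight_def)
qed

end

lemma extend_shrink:
  assumes T: "T \<in> ssyt (Suc m) (conj_skew a b)"
  shows "extend m a b (shrink m a b T) (restrict T (conj_skew (shrink m a b T) b)) = T"
proof
  fix x
  show "extend m a b (shrink m a b T) (restrict T (conj_skew (shrink m a b T) b)) x = T x"
  proof (cases "x \<in> conj_skew a b")
    case True
    moreover have "T x \<in> {1..Suc m}" using ssytD(1)[OF T] True by blast
    ultimately show ?thesis using shrink(4)[OF T True] by (auto simp: extend_def)
  next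
    case False
    then show ?thesis using PiE_arb[OF ssytD(1)[OF T] False] by (simp add: extend_def)
  qed
qed

text \<open>A tableau corresponds to the shape \<open>c\<close> of its entries up to \<open>m\<close>, for which \<open>a / c\<close> is a vertical
  strip, and its restriction to that shape.\<close>

lemma tableaux_branching:
  "(\<Sum>T\<in>ssyt (Suc m) (conj_skew a b). tab_weight y (Suc m) (conj_skew a b) T) = 
   (\<Sum>c | is_partition c \<and> vertical_strip a c \<and> diagram b \<subseteq> diagram c. 
      vertical_weight (y (Suc m)) a c * (\<Sum>T\<in>ssyt m (conj_skew c b). tab_weight y m (conj_skew c b) T))"
proof -
  define C where "C = {c. is_partition c \<and> vertical_strip a c \<and> diagram b \<subseteq> diagram c}"
  have C: "is_partition c" "vertical_strip a c" "\<And>i. b i \<le> c i" if "c \<in> C" for c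
    using that diagram_subset_iff[OF b] by (auto simp: C_def)
  have "C \<subseteq> partitions_upto (num_boxes a)"
  proof
    fix c assume "c \<in> C"
    then show "c \<in> partitions_upto (num_boxes a)"
      using num_boxes_mono[OF a vertical_strip_subset[of c a]] by (simp add: C_def partitions_upto_def)
  qed
  then have finC: "finite C" by (rule finite_subset) (rule finite_partitions_upto)
  have "(\<Sum>c\<in>C. vertical_weight (y (Suc m)) a c * (\<Sum>T\<in>ssyt m (conj_skew c b). tab_weight y m (conj_skew c b) T)) =
    (\<Sum>(c, T)\<in>(SIGMA c:C. ssyt m (conj_skew c b)). 
       vertical_weight (y (Suc m)) a c * tab_weight y m (conj_skew c b) T)"
    unfolding sum_distrib_left using finC C(1) finite_card_conj_skew(1)[OF _ b]
    by (intro sum.Sigma) (auto intro: finite_ssyt)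
  also have "\<dots> = (\<Sum>T\<in>ssyt (Suc m) (conj_skew a b). tab_weight y (Suc m) (conj_skew a b) T)"
  proof (rule sum.reindex_bij_witness[of _ 
        "\<lambda>T. (shrink m a b T, restrict T (conj_skew (shrink m a b T) b))" "\<lambda>(c, T). extend m a b c T"])
    fix z assume "z \<in> (SIGMA c:C. ssyt m (conj_skew c b))"
    then obtain c T where z: "z = (c, T)" and c: "c \<in> C" and T: "T \<in> ssyt m (conj_skew c b)" by auto
    note E = extend[OF C[OF c] T]
    show "(case z of (c, T) \<Rightarrow> extend m a b c T) \<in> ssyt (Suc m) (conj_skew a b)"
      "(shrink m a b (case z of (c, T) \<Rightarrow> extend m a b c T), 
        restrict (case z of (c, T) \<Rightarrow> extend m a b c T) 
          (conj_skew (shrink m a b (case z of (c, T) \<Rightarrow> extend m a b c T)) b)) = z"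
      "tab_weight y (Suc m) (conj_skew a b) (case z of (c, T) \<Rightarrow> extend m a b c T) =
        (case z of (c, T) \<Rightarrow> vertical_weight (y (Suc m)) a c * tab_weight y m (conj_skew c b) T)"
      using E by (simp_all add: z)
  next
    fix T assume T: "T \<in> ssyt (Suc m) (conj_skew a b)"
    show "(case (shrink m a b T, restrict T (conj_skew (shrink m a b T) b)) of (c, T) \<Rightarrow> extend m a b c T) = T"
      by (simp add: extend_shrink[OF T])
    show "(shrink m a b T, restrict T (conj_skew (shrink m a b T) b)) \<in> (SIGMA c:C. ssyt m (conj_skew c b))"
      using shrink(1,2,3,5)[OF T] diagram_subset_iff[OF b] by (simp add: C_def)
  qed
  finally show ?thesis by (simp add: C_def)
qed

end

theorem skew_schur_conj_eq_chain_weight: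
  assumes "is_partition a" "is_partition b" "diagram b \<subseteq> diagram a"
  shows "skew_schur m y (conj_partition a) (conj_partition b) = chain_weight y m a b"
  using assms
proof (induction m arbitrary: a)
  case 0
  have "conj_skew a b = {} \<longleftrightarrow> a = b"
  proof
    assume e: "conj_skew a b = {}"
    have "a i \<le> b i" for i
    proof (rule ccontr)
      assume "\<not> a i \<le> b i"
      moreover from this have "i \<noteq> 0" using partition_0[OF 0(1)] by (cases i) auto
      ultimately have "(a i, i) \<in> conj_skew a b" using 0 by (simp add: mem_conj_skew)
      then show False using e by simp
    qed
    then have "diagram a \<subseteq> diagram b" using diagram_subset_iff[OF 0(1)] by simp
    then show "a = b" using 0 by (intro diagram_inj) auto
  qed (simp add: conj_skew_def skew_def)
  moreover have "ssyt 0 (conj_skew a b) = (if conj_skew a b = {} then {\<lambda>_. undefined} else {})"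
    by (auto simp: ssyt_def PiE_eq_empty_iff)
  ultimately show ?case by (simp add: skew_schur_conj tab_weight_def)
next
  case (Suc m)
  have le: "b i \<le> a i" for i using Suc.prems diagram_subset_iff[of b a] by simp
  have "finite {c. is_partition c \<and> vertical_strip a c}"
    by (rule finite_subset[OF _ finite_partitions_upto[of "num_boxes a"]])
       (use num_boxes_mono[OF Suc.prems(1) vertical_strip_subset[of _ a]] in \<open>auto simp: partitions_upto_def\<close>)
  then have "chain_weight y (Suc m) a b = 
    (\<Sum>c | is_partition c \<and> vertical_strip a c \<and> diagram b \<subseteq> diagram c. 
       vertical_weight (y (Suc m)) a c * chain_weight y m c b)"
    unfolding chain_weight.simps
    by (intro sum.mono_neutral_right) (auto simp: chain_weight_eq_0[OF _ Suc.prems(2)])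
  also have "\<dots> = (\<Sum>c | is_partition c \<and> vertical_strip a c \<and> diagram b \<subseteq> diagram c. 
       vertical_weight (y (Suc m)) a c * (\<Sum>T\<in>ssyt m (conj_skew c b). tab_weight y m (conj_skew c b) T))"
    using Suc.IH Suc.prems(2) by (intro sum.cong refl) (simp add: skew_schur_conj)
  also have "\<dots> = skew_schur (Suc m) y (conj_partition a) (conj_partition b)"
    unfolding skew_schur_conj by (rule tableaux_branching[OF Suc.prems(1,2) le, symmetric])
  finally show ?case ..
qed


section \<open>Power sums times orthosymplectic Schur polynomials\<close>

lemma spo_eq_chain_weight:
  assumes e: "e \<in> partitions_upto K"
  shows "spo n m x y e = (\<Sum>l\<in>partitions_upto K. sp n x l * chain_weight y m e l)"
  unfolding spo_def
proof (rule sum.mono_neutral_cong_left[OF finite_partitions_upto])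
  have p: "is_partition e" using e by (simp add: partitions_upto_def)
  show "{l. is_partition l \<and> diagram l \<subseteq> diagram e} \<subseteq> partitions_upto K"
    using partitions_upto_subset[OF e] by auto
  show "\<forall>l\<in>partitions_upto K - {l. is_partition l \<and> diagram l \<subseteq> diagram e}. 
      sp n x l * chain_weight y m e l = 0"
    using chain_weight_eq_0[OF p, where y = y] by (auto simp: partitions_upto_def)
  fix l assume "l \<in> {l. is_partition l \<and> diagram l \<subseteq> diagram e}"
  then show "sp n x l * skew_schur m y (conj_partition e) (conj_partition l) = 
      sp n x l * chain_weight y m e l"
    using skew_schur_conj_eq_chain_weight[OF p, where y = y] by simp
qed

definition reflected_sum :: "nat \<Rightarrow> nat \<Rightarrow> (nat \<Rightarrow> 'a::field) \<Rightarrow> (nat \<Rightarrow> nat) \<Rightarrow> 'a" where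
  "reflected_sum n r x l = (\<Sum>q = m_index n r l + 1..n. 
     (-1) powi (int (p_index n r l q) - int q + 1) * sp_mu_q n r x l q)"

text \<open>If \<open>l n \<ge> r - 1\<close>, no exponent is small enough to be reflected.\<close>

lemma reflected_sum_eq_0:
  assumes l: "is_partition l" and "\<not> l n < r - 1"
  shows "reflected_sum n r x l = 0"
proof -
  have "\<not> l q + delta n q < r" if "q \<in> {1..n}" for q
    using partition_antimono[OF l, of q n] that assms(2) by (auto simp: delta_def)
  then have "{m_index n r l + 1..n} = {}" unfolding m_index_interval[OF l] by blast
  then show ?thesis unfolding reflected_sum_def by simp
qed

text \<open>In matrix form the product is \<open>s (p W)\<close> with \<open>s\<close> the vector of symplectic Schur polynomials
  and \<open>W\<close> the chain weights.  The strips added by the \<open>x\<close>-part cancel against the strips removed from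
  the inner partition by the \<open>y\<close>-part.  What remains are the strips added to \<open>\<nu>\<close>, the strips removed
  in the \<open>x\<close>-part, which commute through \<open>W\<close> and become strips removed from \<open>\<nu>\<close>, and the reflected
  terms.\<close>

theorem power_sum_times_spo:
  fixes x y :: "nat \<Rightarrow> 'a::field"
  assumes r: "r \<ge> 1" and v: "is_partition \<nu>" "num_parts \<nu> \<le> n"
  shows "power_sum r n m x y * spo n m x y \<nu> =
      (\<Sum>\<eta> | strip r \<eta> \<nu>. strip_sign \<eta> \<nu> * spo n m x y \<eta>)
    + (\<Sum>\<xi> | strip r \<nu> \<xi>. strip_sign \<nu> \<xi> * spo n m x y \<xi>)
    + (\<Sum>\<mu> | is_partition \<mu> \<and> diagram \<mu> \<subseteq> diagram \<nu> \<and> \<mu> n < r - 1.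
         reflected_sum n r x \<mu> * skew_schur m y (conj_partition \<nu>) (conj_partition \<mu>))"
proof -
  \<comment> \<open>Large enough for all partitions obtained by adding a strip to a partition inside \<open>\<nu>\<close>.\<close>
  define K where "K = num_boxes \<nu> + r"
  let ?P = "partitions_upto K" and ?R = "strip_matrix r" and ?W = "chain_weight y m"
  let ?s = "sp n x" and ?C = "reflected_sum n r x"
  define px where "px = (\<Sum>i = 1..n. x i ^ r + inverse (x i) ^ r)"
  define py where "py = (-1) ^ (r - 1) * (\<Sum>j = 1..m. y j ^ r)"
  have vP: "\<nu> \<in> ?P" using v by (simp add: partitions_upto_def K_def)
  have X: "px * ?s l * ?W \<nu> l = ((\<Sum>e\<in>?P. ?R e l * ?s e) + (\<Sum>k\<in>?P. ?R l k * ?s k) + ?C l) * ?W \<nu> l"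
    if l: "l \<in> ?P" for l
  proof (cases "diagram l \<subseteq> diagram \<nu>")
    case False
    then show ?thesis using chain_weight_eq_0[OF v(1), of l y] l by (simp add: partitions_upto_def)
  next
    case True
    have lp: "is_partition l" using l by (simp add: partitions_upto_def)
    have ln: "num_parts l \<le> n" 
      using True v num_parts_le_iff[OF v(1)] num_parts_le_iff[OF lp] diagram_subset_iff[OF lp] 
      by (metis le_zero_eq)
    have "num_boxes l + r \<le> K" using num_boxes_mono[OF v(1) True] by (simp add: K_def)
    then have "(\<Sum>e | strip r e l \<and> num_parts e \<le> n. strip_sign e l * ?s e) = (\<Sum>e\<in>?P. ?R e l * ?s e)"
      using strip_in_partitions_upto[of r _ l K]
      by (intro sum.mono_neutral_cong_left finite_partitions_upto) (auto simp: strip_matrix_def sp_def)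
    then show ?thesis
      unfolding px_def power_sum_times_sp[OF r lp ln] sum_strip_matrix_down[OF l] reflected_sum_def
      by simp
  qed
  have Y: "py * ?W \<nu> l = (\<Sum>e\<in>?P. ?R e \<nu> * ?W e l) - (\<Sum>k\<in>?P. ?R l k * ?W \<nu> k)" if l: "l \<in> ?P" for l
    using chain_weight_add_commute[OF r vP _ l, of y m] by (simp add: K_def py_def)
  have "power_sum r n m x y * spo n m x y \<nu> = 
     (\<Sum>l\<in>?P. px * ?s l * ?W \<nu> l) + (\<Sum>l\<in>?P. ?s l * (py * ?W \<nu> l))"
    unfolding spo_eq_chain_weight[OF vP] power_sum_def px_def[symmetric] py_def[symmetric]
    by (simp add: distrib_right sum_distrib_left sum.distrib mult_ac)
  also have "(\<Sum>l\<in>?P. px * ?s l * ?W \<nu> l) = 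
     (\<Sum>l\<in>?P. (\<Sum>e\<in>?P. ?s e * ?R e l) * ?W \<nu> l) + (\<Sum>l\<in>?P. (\<Sum>k\<in>?P. ?s k * ?R l k) * ?W \<nu> l) + 
     (\<Sum>l\<in>?P. ?C l * ?W \<nu> l)"
  proof -
    have "px * ?s l * ?W \<nu> l = (\<Sum>e\<in>?P. ?s e * ?R e l) * ?W \<nu> l + 
        (\<Sum>k\<in>?P. ?s k * ?R l k) * ?W \<nu> l + ?C l * ?W \<nu> l" if "l \<in> ?P" for l
      unfolding X[OF that] by (simp add: distrib_right mult.commute[of "?R _ _"])
    then show ?thesis by (simp only: sum.distrib cong: sum.cong)
  qed
  also have "(\<Sum>l\<in>?P. ?s l * (py * ?W \<nu> l)) = 
     (\<Sum>l\<in>?P. ?s l * (\<Sum>e\<in>?P. ?W e l * ?R e \<nu>)) - (\<Sum>l\<in>?P. ?s l * (\<Sum>k\<in>?P. ?R l k * ?W \<nu> k))"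
    by (simp add: Y right_diff_distrib sum_subtractf mult.commute)
  also have "(\<Sum>l\<in>?P. ?s l * (\<Sum>k\<in>?P. ?R l k * ?W \<nu> k)) = (\<Sum>l\<in>?P. (\<Sum>e\<in>?P. ?s e * ?R e l) * ?W \<nu> l)"
    by (rule sum_matrix_assoc)
  also have "(\<Sum>l\<in>?P. ?s l * (\<Sum>e\<in>?P. ?W e l * ?R e \<nu>)) = (\<Sum>\<eta> | strip r \<eta> \<nu>. strip_sign \<eta> \<nu> * spo n m x y \<eta>)"
  proof -
    have "(\<Sum>l\<in>?P. ?s l * (\<Sum>e\<in>?P. ?W e l * ?R e \<nu>)) = (\<Sum>e\<in>?P. (\<Sum>l\<in>?P. ?s l * ?W e l) * ?R e \<nu>)"
      by (rule sum_matrix_assoc)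
    also have "\<dots> = (\<Sum>e\<in>?P. ?R e \<nu> * spo n m x y e)"
      by (simp add: spo_eq_chain_weight mult.commute)
    also have "\<dots> = (\<Sum>\<eta> | strip r \<eta> \<nu>. strip_sign \<eta> \<nu> * spo n m x y \<eta>)"
      using strip_in_partitions_upto[of r _ \<nu> K] by (intro sum_strip_matrix_up[symmetric]) (auto simp: K_def)
    finally show ?thesis .
  qed
  also have "(\<Sum>l\<in>?P. (\<Sum>k\<in>?P. ?s k * ?R l k) * ?W \<nu> l) = (\<Sum>\<xi> | strip r \<nu> \<xi>. strip_sign \<nu> \<xi> * spo n m x y \<xi>)"
  proof -
    have "(\<Sum>l\<in>?P. (\<Sum>k\<in>?P. ?s k * ?R l k) * ?W \<nu> l) = (\<Sum>k\<in>?P. ?s k * (\<Sum>l\<in>?P. ?R l k * ?W \<nu> l))"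
      by (rule sum_matrix_assoc[symmetric])
    also have "\<dots> = (\<Sum>k\<in>?P. ?s k * (\<Sum>z\<in>?P. ?W z k * ?R \<nu> z))"
      using chain_weight_remove_commute[OF r vP, of _ y m] by (simp add: mult.commute)
    also have "\<dots> = (\<Sum>z\<in>?P. (\<Sum>k\<in>?P. ?s k * ?W z k) * ?R \<nu> z)"
      by (rule sum_matrix_assoc)
    also have "\<dots> = (\<Sum>z\<in>?P. ?R \<nu> z * spo n m x y z)"
      by (simp add: spo_eq_chain_weight mult.commute)
    also have "\<dots> = (\<Sum>\<xi> | strip r \<nu> \<xi>. strip_sign \<nu> \<xi> * spo n m x y \<xi>)"
      by (rule sum_strip_matrix_down[OF vP, symmetric])
    finally show ?thesis .
  qed
  also have "(\<Sum>l\<in>?P. ?C l * ?W \<nu> l) = 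
    (\<Sum>\<mu> | is_partition \<mu> \<and> diagram \<mu> \<subseteq> diagram \<nu> \<and> \<mu> n < r - 1.
       ?C \<mu> * skew_schur m y (conj_partition \<nu>) (conj_partition \<mu>))"
  proof (rule sum.mono_neutral_cong_right[OF finite_partitions_upto])
    show "{\<mu>. is_partition \<mu> \<and> diagram \<mu> \<subseteq> diagram \<nu> \<and> \<mu> n < r - 1} \<subseteq> ?P"
      using partitions_upto_subset[OF vP] by auto
    show "\<forall>l\<in>?P - {\<mu>. is_partition \<mu> \<and> diagram \<mu> \<subseteq> diagram \<nu> \<and> \<mu> n < r - 1}. ?C l * ?W \<nu> l = 0"
    proof
      fix l assume l: "l \<in> ?P - {\<mu>. is_partition \<mu> \<and> diagram \<mu> \<subseteq> diagram \<nu> \<and> \<mu> n < r - 1}"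
      then have lp: "is_partition l" by (simp add: partitions_upto_def)
      then have "\<not> diagram l \<subseteq> diagram \<nu> \<or> \<not> l n < r - 1" using l by blast
      then show "?C l * ?W \<nu> l = 0"
        using chain_weight_eq_0[OF v(1) lp, of y] reflected_sum_eq_0[OF lp] by auto
    qed
    fix l assume "l \<in> {\<mu>. is_partition \<mu> \<and> diagram \<mu> \<subseteq> diagram \<nu> \<and> \<mu> n < r - 1}"
    then show "?C l * ?W \<nu> l = ?C l * skew_schur m y (conj_partition \<nu>) (conj_partition l)"
      using skew_schur_conj_eq_chain_weight[OF v(1), where y = y] by simp
  qed
  finally show ?thesis by simp
qed

theorem theorem4p3:
  fixes n m r :: nat and \<nu> :: "nat \<Rightarrow> nat"
  assumes "n \<ge> 1" and "r \<ge> 1"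
    and "is_partition \<nu>" and "num_parts \<nu> \<le> n"
  shows "power_sum r n m X (Y n) * spo n m X (Y n) \<nu> =
      (\<Sum>\<eta> | is_partition \<eta> \<and> diagram \<nu> \<subseteq> diagram \<eta> \<and> skew \<eta> \<nu> \<in> BS r.
         (-1) ^ ht (skew \<eta> \<nu>) * spo n m X (Y n) \<eta>)
    + (\<Sum>\<xi> | is_partition \<xi> \<and> diagram \<xi> \<subseteq> diagram \<nu> \<and> skew \<nu> \<xi> \<in> BS r.
         (-1) ^ ht (skew \<nu> \<xi>) * spo n m X (Y n) \<xi>)
    + (\<Sum>\<mu> | is_partition \<mu> \<and> diagram \<mu> \<subseteq> diagram \<nu> \<and> \<mu> n < r - 1.
         (\<Sum>q = m_index n r \<mu> + 1..n.
            (-1) powi (int (p_index n r \<mu> q) - int q + 1) * sp_mu_q n r X \<mu> q)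
         * skew_schur m (Y n) (conj_partition \<nu>) (conj_partition \<mu>))"
proof -
  have "{\<eta>. is_partition \<eta> \<and> diagram \<nu> \<subseteq> diagram \<eta> \<and> skew \<eta> \<nu> \<in> BS r} = {\<eta>. strip r \<eta> \<nu>}"
    "{\<xi>. is_partition \<xi> \<and> diagram \<xi> \<subseteq> diagram \<nu> \<and> skew \<nu> \<xi> \<in> BS r} = {\<xi>. strip r \<nu> \<xi>}"
    using assms(3) by (auto simp: strip_def)
  then show ?thesis
    using power_sum_times_spo[OF assms(2-4), of m X "Y n"]
    by (simp only: strip_sign_def reflected_sum_def)
qed

end
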